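(* As power series (Laurent series where negative powers appear) in $q$, $|q|<1$: (1) \begin{align*} &\sum_{n\ge0}N^{0}(0,4;2n+1)q^n=q^5g(-q^8;q^{16})-q\frac{J_{8}^8J_{32}^2}{J_{4}^4J_{16}^5}+\frac{1}{2}\left(\frac{J_{2}^8J_{8}^2}{J_{1}^4J_{4}^5}+\frac{J_{4}^3}{J_{2}^2} \right),\\ &\sum_{n\ge0}N^{0}(0,4;4n+1)q^n=\frac{J_{2}^4J_{8}^5}{J_{1}^4J_{4}^2J_{16}^2},\qquad \sum_{n\ge0}N^{0}(0,4;4n+3)q^n=q^2g(-q^4;q^8)-\frac{J_{4}^8J_{16}^2}{J_{2}^4J_{8}^5}+2\frac{J_{4}^6}{J_{1}^2J_{2}^3},\\ &\sum_{n\ge0}N^{0}(0,4;8n+1)q^n=\frac{J_{2}^{12}J_{4}}{J_{1}^{10}J_{8}^2},\qquad \sum_{n\ge0}N^{0}(0,4;8n+3)q^n=qg(-q^2;q^4)+2\frac{J_{2}^6J_{4}^5}{J_{1}^8J_{8}^2}-\frac{J_{2}^8J_{8}^2}{J_{1}^4J_{4}^5},\\ &\sum_{n\ge0}N^{0}(0,4;8n+5)q^n=4\frac{J_{4}^9}{J_{1}^6J_{8}^2},\qquad \sum_{n\ge0}N^{0}(0,4;8n+7)q^n=4\frac{J_{2}^8J_{8}^2}{J_{1}^8J_{4}}. \end{align*} (2) \begin{align*} &\sum_{n\ge0}N^{0}(1,4;2n)q^n=-\frac{1}{2}+\frac{1}{2}g(-1;q^4)+\frac{1}{4}\frac{J_{2}^6J_{4}}{J_{1}^4J_{8}^2},\qquad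 \sum_{n\ge0}N^{0}(1,4;4n)q^n=-\frac{1}{2}+\frac{1}{2}g(-1;q^2)+\frac{1}{4}\frac{J_{2}^{15}}{J_{1}^8J_{4}^6},\\ &\sum_{n\ge0}N^{0}(1,4;4n+2)q^n=\frac{J_{2}^3J_{4}^2}{J_{1}^4},\qquad \sum_{n\ge0}N^{0}(1,4;8n)q^n=-\frac{1}{2}+\frac{1}{2}g(-1;q)+\frac{1}{4}\frac{J_{2}^{22}}{J_{1}^{13}J_{4}^8}+4q\frac{J_{4}^8}{J_{1}^5J_{2}^2},\\ &\sum_{n\ge0}N^{0}(1,4;8n+2)q^n=\frac{J_{2}^{16}}{J_{1}^{11}J_{4}^4},\qquad \sum_{n\ge0}N^{0}(1,4;8n+4)q^n=2\frac{J_{2}^{10}}{J_{1}^9},\qquad \sum_{n\ge0}N^{0}(1,4;8n+6)q^n=4\frac{J_{2}^4J_{4}^4}{J_{1}^7}. \end{align*} (3) \begin{align*} &\sum_{n\ge0}N^{0}(2,4;2n+1)q^n=-q^{-1}+q^{-1}g(-1;q^{16})+\frac{1}{2}q^{-1}\frac{J_{8}^{6}J_{16}}{J_{4}^4J_{32}^2}-\frac{1}{2}\frac{J_{4}^3}{J_{2}^2}+\frac{1}{2}\frac{J_{2}^8J_{8}^2}{J_{1}^4J_{4}^5},\\ &\sum_{n\ge0}N^{0}(2,4;4n+1)q^n=2q\frac{J_{2}^4J_{16}^2}{J_{1}^4J_{8}},\qquad \sum_{n\ge0}N^{0}(2,4;4n+3)q^n=-q^{-1}+q^{-1}g(-1;q^8)+\frac{1}{2}q^{-1}\frac{J_{4}^6J_{8}}{J_{2}^4J_{16}^2}+2\frac{J_{4}^6}{J_{1}^2J_{2}^3},\\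 &\sum_{n\ge0}N^{0}(2,4;8n+1)q^n=8q\frac{J_{2}^2J_{4}^3J_{8}^2}{J_{1}^6},\qquad \sum_{n\ge0}N^{0}(2,4;8n+3)q^n=2\frac{J_{2}^6J_{4}^5}{J_{1}^8J_{8}^2},\qquad \sum_{n\ge0}N^{0}(2,4;8n+5)q^n=2\frac{J_{2}^{14}J_{8}^2}{J_{1}^{10}J_{4}^5},\\ &\sum_{n\ge0}N^{0}(2,4;8n+7)q^n=-q^{-1}+q^{-1}g(-1;q^4)+\frac{1}{2}q^{-1}\frac{J_{2}^6J_4}{J_{1}^4J_{8}^2} +4\frac{J_{2}^8J_{8}^2}{J_{1}^8J_{4}}. \end{align*}
   Context: For $|q|<1$: $(a;q)_n=\prod_{k=0}^{n-1}(1-aq^k)$, $(a;q)_\infty=\prod_{k\ge0}(1-aq^k)$, $J_m=(q^m;q^m)_\infty$, and for $x$ not an integer power of $q$, \[g(x;q)=x^{-1}\Big(-1+\sum_{n=0}^{\infty}\frac{q^{n^2}}{(x;q)_{n+1}(q/x;q)_{n}}\Big)\] (expressions such as $g(-q^8;q^{16})$ mean this function with $x=-q^8$ and $q$ replaced by $q^{16}$). An odd Durfee symbol of a positive integer $n$ consists of a nonnegative integer $D$ together with two (possibly empty) non-increasing sequences of odd positive integers $a_1\ge\cdots\ge a_s$ (top row) and $b_1\ge\cdots\ge b_t$ (bottom row), all entries at most $2D+1$, with $n=\sum a_i+\sum b_j+2D^2+2D+1$; its odd rank is $s-t$. $N^{0}(a,M;n)$ is the number of odd Durfee symbols of $n$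 with odd rank congruent to $a$ modulo $M$, and $N^0(a,M;0)=0$. *)

theory Defs
  imports "HOL-Analysis.Analysis" "HOL-Number_Theory.Cong"
begin

definition qpoch :: "complex \<Rightarrow> complex \<Rightarrow> nat \<Rightarrow> complex" where
  "qpoch a q n = (\<Prod>k<n. 1 - a * q ^ k)"

definition qpoch_inf :: "complex \<Rightarrow> complex \<Rightarrow> complex" where
  "qpoch_inf a q = (\<Prod>k. 1 - a * q ^ k)"

definition J :: "nat \<Rightarrow> complex \<Rightarrow> complex" where
  "J m q = qpoch_inf (q ^ m) (q ^ m)"

text \<open>Meaningful for \<open>norm q < 1\<close> and \<open>x\<close> nonzero and not an integer power of \<open>q\<close>.\<close>

definition g :: "complex \<Rightarrow> complex \<Rightarrow> complex" where
  "g x q = inverse x * (- 1 + (\<Sum>n. q ^ (n\<^sup>2) / (qpoch x q (n + 1) * qpoch (q / x) q n)))"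

text \<open>A symbol is a triple of \<open>D\<close>, the top row and the bottom row.\<close>

definition odd_durfee_symbols :: "nat \<Rightarrow> (nat \<times> nat list \<times> nat list) set" where
  "odd_durfee_symbols n =
     {(D, as, bs).
        sorted_wrt (\<ge>) as \<and> sorted_wrt (\<ge>) bs \<and>
        (\<forall>x \<in> set as \<union> set bs. odd x \<and> x \<le> 2 * D + 1) \<and>
        n = sum_list as + sum_list bs + 2 * D\<^sup>2 + 2 * D + 1}"

fun odd_rank :: "nat \<times> nat list \<times> nat list \<Rightarrow> int" where
  "odd_rank (D, as, bs) = int (length as) - int (length bs)"

definition N0 :: "int \<Rightarrow> nat \<Rightarrow> nat \<Rightarrow> nat" where
  "N0 a M n = card {S \<in> odd_durfee_symbols n. [odd_rank S = a] (mod int M)}"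

lemma finite_odd_durfee_symbols: "finite (odd_durfee_symbols n)"
proof -
  define L where "L = {xs. set xs \<subseteq> {..n} \<and> length xs \<le> n}"
  have len: "length xs \<le> sum_list xs" if "\<forall>x\<in>set xs. odd x" for xs :: "nat list"
    using that
  proof (induction xs)
    case (Cons x xs)
    then have "x \<ge> 1" by (auto intro: Suc_leI odd_pos)
    with Cons show ?case by simp
  qed simp
  have "xs \<in> L" if "\<forall>x\<in>set xs. odd x" "sum_list xs \<le> n" for xs
    using len[OF that(1)] that(2) member_le_sum_list[of _ xs]
    unfolding L_def by (auto intro: order_trans)
  then have "odd_durfee_symbols n \<subseteq> {..n} \<times> L \<times> L"
    by (auto simp: odd_durfee_symbols_def)
  moreover have "finite L"
    unfolding L_def by (rule finite_lists_length_le) simp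
  ultimately show ?thesis
    by (meson finite_SigmaI finite_atMost finite_subset)
qed

lemma N0_at_0: "N0 a M 0 = 0"
  by (simp add: N0_def odd_durfee_symbols_def)

end

theory Submission
  imports Defs "HOL-Complex_Analysis.Complex_Analysis"
begin

text \<open>
  Write \<open>R(z; q)\<close> for the generating function of odd Durfee symbols by odd rank; it equals \<open>q g(z q; q\<^sup>2)\<close>,
  so summing over fourth roots of unity expresses everything through \<open>\<omega>(\<plusminus>q) = g(\<plusminus>q; q\<^sup>2)\<close> and \<open>g(\<i>q; q\<^sup>2)\<close>.

  The two-dissection of \<open>\<omega>\<close> is a special case of an identity in a free variable \<open>x\<close>,
  \<open>g(x; q) = - 1/x + q g(- q/x\<^sup>2; q\<^sup>4)/x\<^sup>3 - q g(- q x\<^sup>2; q\<^sup>4) + C/(x \<theta>(x; q) \<theta>(- q x\<^sup>2; q\<^sup>4) \<theta>(- q/x\<^sup>2; q\<^sup>4))\<close>.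
  After multiplication by the theta functions all terms are holomorphic for \<open>x \<noteq> 0\<close>, and the functional equation
  \<open>g(q x; q) = - x\<^sup>3 g(x; q) - x - x\<^sup>2\<close> makes the result invariant under \<open>x \<mapsto> q x\<close>, hence constant by the
  maximum principle; \<open>x = 1\<close> yields the constant. The part of this identity that is even in \<open>x\<close> stays regular at
  \<open>x\<^sup>2 = - q\<close> and there evaluates \<open>g(\<i>q; q\<^sup>2)\<close>. The remaining progressions follow from the two-dissections of
  \<open>1/J\<^sub>1\<^sup>2\<close> and \<open>1/J\<^sub>1\<^sup>4\<close>, which are consequences of splitting the theta function into its even and odd parts.
\<close>

section \<open>Infinite q-products\<close>

text \<open>The value g(i q; q^2) is the obstacle. In base q^2 the point x = i q satisfies x^2 =
  -q^2, which is a zero of theta(-q^2/x^2; q^8), the denominator of one of the g-terms, so the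
  free-variable identity cannot be divided out there. Passing to the even part helps because
  theta(-x) - theta(x), by which the constant gets multiplied, contains the same zero. It is also
  enough: reflection sends x = i q to -x, so g takes equal values at both points. In the
  progressions, each mock contribution is a power of q times a function of a power of q, arranged so
  that every halving of the index moves it as a whole into one residue class. Only products of
  \<open>J\<close> have to be dissected, and all classes that the mock term leaves are given by pure
  products. The series are treated as convergent sums at every q with 0 < |q| < 1; a negative power
  of q in a closed form then needs no Laurent series.\<close>

lemma norm_power_lt_1:
  fixes q :: complex
  assumes "norm q < 1" "n > 0"
  shows "norm (q ^ n) < 1"
  using assms by (simp add: norm_power power_less_one_iff)

lemma convergent_qpoch:
  fixes a q :: complex
  assumes "norm q < 1"
  shows "convergent_prod (\<lambda>k. 1 - a * q ^ k)"
proof -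
  have "summable (\<lambda>k. norm a * norm q ^ k)"
    using assms by (intro summable_mult summable_geometric) simp
  moreover have "norm ((1 - a * q ^ k) - 1) = norm a * norm q ^ k" for k
    by (simp add: norm_mult norm_power)
  ultimately have "summable (\<lambda>k. norm ((1 - a * q ^ k) - 1))"
    by simp
  then show ?thesis
    using abs_convergent_prod_conv_summable abs_convergent_prod_imp_convergent_prod by blast
qed

lemma qpoch_tendsto_qpoch_inf:
  assumes "norm q < 1"
  shows "(\<lambda>n. qpoch a q n) \<longlonglongrightarrow> qpoch_inf a q"
  using convergent_prod_LIMSEQ[OF convergent_qpoch[OF assms, of a]]
  unfolding qpoch_def qpoch_inf_def by (simp only: LIMSEQ_lessThan_iff_atMost)

lemma qpoch_rec: "qpoch a q (Suc n) = (1 - a) * qpoch (a * q) q n"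
  unfolding qpoch_def by (subst prod.lessThan_Suc_shift) (simp add: mult.assoc)

lemma qpoch_inf_rec:
  assumes "norm q < 1"
  shows "qpoch_inf a q = (1 - a) * qpoch_inf (a * q) q"
proof (rule LIMSEQ_unique)
  show "(\<lambda>n. qpoch a q (Suc n)) \<longlonglongrightarrow> qpoch_inf a q"
    by (rule LIMSEQ_Suc[OF qpoch_tendsto_qpoch_inf[OF assms]])
  show "(\<lambda>n. qpoch a q (Suc n)) \<longlonglongrightarrow> (1 - a) * qpoch_inf (a * q) q"
    unfolding qpoch_rec by (intro tendsto_intros qpoch_tendsto_qpoch_inf assms)
qed

lemma qpoch_inf_split:
  assumes "norm q < 1"
  shows "qpoch_inf a q = qpoch a q n * qpoch_inf (a * q ^ n) q"
proof (induction n)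
  case (Suc n)
  then show ?case
    using qpoch_inf_rec[OF assms, of "a * q ^ n"] by (simp add: qpoch_def mult_ac)
qed (simp add: qpoch_def)

lemma qpoch_inf_zero [simp]: "qpoch_inf 0 q = 1"
  by (simp add: qpoch_inf_def)

lemma qpoch_inf_one:
  assumes "norm q < 1"
  shows "qpoch_inf 1 q = 0"
  using qpoch_inf_rec[OF assms, of 1] by simp

lemma qpoch_inf_nonzero:
  assumes "norm q < 1" "\<And>k. a * q ^ k \<noteq> 1"
  shows "qpoch_inf a q \<noteq> 0"
  unfolding qpoch_inf_def
  by (rule prodinf_nonzero[OF convergent_qpoch[OF assms(1)]]) (metis assms(2) eq_iff_diff_eq_0)

lemma qpoch_inf_nonzero':
  assumes "norm q < 1" "norm a < 1"
  shows "qpoch_inf a q \<noteq> 0"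
proof (rule qpoch_inf_nonzero[OF assms(1)])
  fix k
  have "norm (a * q ^ k) \<le> norm a * 1"
    unfolding norm_mult norm_power
    by (intro mult_left_mono power_le_one) (use assms in auto)
  then show "a * q ^ k \<noteq> 1"
    using assms(2) by auto
qed

text \<open>The bound is free of \<open>n\<close>: 1 + t \<le> exp t turns the product into the
  exponential of a partial geometric sum. It therefore passes to the infinite product.\<close>

lemma norm_qpoch_le:
  assumes "norm q < 1"
  shows "norm (qpoch a q n) \<le> exp (norm a / (1 - norm q))"
proof -
  have "norm (qpoch a q n) \<le> (\<Prod>k<n. 1 + norm a * norm q ^ k)"
    unfolding qpoch_def prod_norm[symmetric]
    by (intro prod_mono) (metis norm_ge_zero norm_mult norm_one norm_power norm_triangle_ineq4)
  also have "\<dots> \<le> exp (\<Sum>k<n. norm a * norm q ^ k)"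
    by (rule prod_le_exp_sum) auto
  also have "(\<Sum>k<n. norm a * norm q ^ k) \<le> norm a / (1 - norm q)"
  proof -
    have "(\<lambda>k. norm a * norm q ^ k) sums (norm a * (1 / (1 - norm q)))"
      using assms by (intro sums_mult geometric_sums) simp
    then show ?thesis
      using sum_le_suminf[of "\<lambda>k. norm a * norm q ^ k" "{..<n}"] by (simp add: sums_iff)
  qed
  finally show ?thesis by simp
qed

lemma norm_qpoch_inf_le:
  assumes "norm q < 1"
  shows "norm (qpoch_inf a q) \<le> exp (norm a / (1 - norm q))"
  by (rule LIMSEQ_le_const2[OF tendsto_norm[OF qpoch_tendsto_qpoch_inf[OF assms]]])
    (use norm_qpoch_le[OF assms] in auto)

lemma qpoch_inf_holomorphic:
  assumes "norm q < 1"
  shows "(\<lambda>a. qpoch_inf a q) holomorphic_on UNIV"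
proof (rule holomorphic_uniform_sequence[where f = "\<lambda>n a. qpoch a q n"])
  fix x :: complex
  have "uniformly_convergent_on (cball x 1) (\<lambda>N a. \<Prod>k<N. 1 - a * q ^ k)"
  proof (rule uniformly_convergent_on_prod')
    have "uniformly_convergent_on (cball x 1) (\<lambda>N a. \<Sum>n<N. norm (a * q ^ n))"
    proof (rule Weierstrass_m_test')
      fix n and a assume "a \<in> cball x 1"
      then have "norm a \<le> norm x + 1"
        by (metis diff_add_cancel dist_norm dist_commute mem_cball norm_triangle_le add.commute add_left_mono)
      then show "norm (norm (a * q ^ n)) \<le> (norm x + 1) * norm q ^ n"
        by (simp add: norm_mult norm_power mult_right_mono)
    qed (use assms in \<open>auto intro!: summable_mult summable_geometric\<close>)
    then show "uniformly_convergent_on (cball x 1) (\<lambda>N a. \<Sum>n<N. norm (1 - a * q ^ n - 1))"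
      by simp
  qed (auto intro!: continuous_intros)
  then have "uniform_limit (cball x 1) (\<lambda>n a. qpoch a q n) (\<lambda>a. lim (\<lambda>n. qpoch a q n)) sequentially"
    unfolding qpoch_def uniformly_convergent_uniform_limit_iff .
  also have "(\<lambda>a. lim (\<lambda>n. qpoch a q n)) = (\<lambda>a. qpoch_inf a q)"
    using qpoch_tendsto_qpoch_inf[OF assms] limI by blast
  finally show "\<exists>d>0. cball x d \<subseteq> UNIV \<and>
      uniform_limit (cball x d) (\<lambda>n a. qpoch a q n) (\<lambda>a. qpoch_inf a q) sequentially"
    by (intro exI[of _ 1]) auto
qed (auto simp: qpoch_def intro!: holomorphic_intros)

lemma holomorphic_on_qpoch_inf [holomorphic_intros]:
  assumes "norm q < 1" "f holomorphic_on S"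
  shows "(\<lambda>x. qpoch_inf (f x) q) holomorphic_on S"
  using holomorphic_on_compose_gen[OF assms(2) qpoch_inf_holomorphic[OF assms(1)]]
  by (simp add: o_def)

lemma qpoch_inf_tendsto:
  assumes "norm q < 1" "(f \<longlongrightarrow> a) F"
  shows "((\<lambda>x. qpoch_inf (f x) q) \<longlongrightarrow> qpoch_inf a q) F"
proof -
  have "isCont (\<lambda>a. qpoch_inf a q) a"
    using holomorphic_on_imp_continuous_on[OF qpoch_inf_holomorphic[OF assms(1)]]
    by (simp add: continuous_on_eq_continuous_at)
  then show ?thesis
    using assms(2) by (rule isCont_tendsto_compose)
qed

lemma qpoch_inf_even_odd:
  assumes "norm q < 1"
  shows "qpoch_inf a q = qpoch_inf a (q\<^sup>2) * qpoch_inf (a * q) (q\<^sup>2)"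
proof (rule LIMSEQ_unique)
  have q2: "norm (q\<^sup>2) < 1"
    using norm_power_lt_1[OF assms] by simp
  have eq: "qpoch a q (2 * n) = qpoch a (q\<^sup>2) n * qpoch (a * q) (q\<^sup>2) n" for n
    by (induction n) (simp_all add: qpoch_def power_mult[symmetric] power_add mult_ac)
  show "(\<lambda>n. qpoch a q (2 * n)) \<longlonglongrightarrow> qpoch_inf a q"
    using LIMSEQ_subseq_LIMSEQ[OF qpoch_tendsto_qpoch_inf[OF assms], of "\<lambda>n. 2 * n"]
    by (simp add: o_def strict_mono_def)
  show "(\<lambda>n. qpoch a q (2 * n)) \<longlonglongrightarrow> qpoch_inf a (q\<^sup>2) * qpoch_inf (a * q) (q\<^sup>2)"
    unfolding eq by (intro tendsto_intros qpoch_tendsto_qpoch_inf q2)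
qed

lemma qpoch_inf_mult_minus:
  assumes "norm q < 1"
  shows "qpoch_inf a q * qpoch_inf (- a) q = qpoch_inf (a\<^sup>2) (q\<^sup>2)"
proof (rule LIMSEQ_unique)
  have q2: "norm (q\<^sup>2) < 1"
    using norm_power_lt_1[OF assms] by simp
  have eq: "qpoch a q n * qpoch (- a) q n = qpoch (a\<^sup>2) (q\<^sup>2) n" for n
    unfolding qpoch_def prod.distrib[symmetric]
    by (intro prod.cong) (auto simp: algebra_simps power2_eq_square power_mult_distrib)
  show "(\<lambda>n. qpoch (a\<^sup>2) (q\<^sup>2) n) \<longlonglongrightarrow> qpoch_inf (a\<^sup>2) (q\<^sup>2)"
    by (intro qpoch_tendsto_qpoch_inf q2)
  show "(\<lambda>n. qpoch (a\<^sup>2) (q\<^sup>2) n) \<longlonglongrightarrow> qpoch_inf a q * qpoch_inf (- a) q"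
    unfolding eq[symmetric] by (intro tendsto_intros qpoch_tendsto_qpoch_inf assms)
qed

section \<open>Theta functions and the numerator of g\<close>

text \<open>Jacobi's theta function without the factor (q; q)_inf of the triple product; this is why
  explicit factors \<open>J\<close> appear in its dissection.\<close>

definition qtheta :: "complex \<Rightarrow> complex \<Rightarrow> complex" where
  "qtheta x q = qpoch_inf x q * qpoch_inf (q / x) q"

text \<open>\<open>gnum x q\<close> is \<open>g x q * qtheta x q\<close> with the poles at the integer powers of \<open>q\<close> cancelled.\<close>

definition gnum :: "complex \<Rightarrow> complex \<Rightarrow> complex" where
  "gnum x q = (\<Sum>n. q ^ (n * (n + 1)) * (qpoch_inf (x * q ^ (n + 1)) q * qpoch_inf (q ^ (n + 2) / x) q))"

lemma norm_power_mult_le: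
  fixes q c :: complex
  assumes "norm q < 1" "n \<le> e" "norm c \<le> B"
  shows "norm (q ^ e * c) \<le> B * norm q ^ n"
proof -
  have "norm q ^ e \<le> norm q ^ n"
    using assms by (intro power_decreasing) auto
  then have "norm q ^ e * norm c \<le> norm q ^ n * B"
    using assms by (intro mult_mono) auto
  then show ?thesis
    by (simp add: norm_mult norm_power mult.commute)
qed

lemma summable_power_mult_bounded:
  fixes q :: complex
  assumes "norm q < 1" "\<And>n. n \<le> e n" "\<And>n. norm (c n) \<le> B"
  shows "summable (\<lambda>n. q ^ e n * c n)"
proof (rule summable_comparison_test')
  show "summable (\<lambda>n. B * norm q ^ n)"
    using assms(1) by (intro summable_mult summable_geometric) simp
qed (use norm_power_mult_le assms in blast)

text \<open>Uniform in both exponents and in x on a closed annulus around 0, as the Weierstrass test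
  and the remainder estimates require.\<close>

lemma norm_qpoch_inf_pair_le:
  assumes "norm q < 1" "norm x \<le> A" "norm (inverse x) \<le> B"
  shows "norm (qpoch_inf (x * q ^ m) q * qpoch_inf (q ^ k / x) q) \<le> exp (A / (1 - norm q)) * exp (B / (1 - norm q))"
  unfolding norm_mult
proof (rule mult_mono)
  have "norm (x * q ^ m) \<le> A * 1"
    unfolding norm_mult norm_power
    by (intro mult_mono power_le_one) (use assms order_trans[OF norm_ge_zero assms(2)] in auto)
  then show "norm (qpoch_inf (x * q ^ m) q) \<le> exp (A / (1 - norm q))"
    by (intro order_trans[OF norm_qpoch_inf_le]) (use assms in \<open>auto intro!: divide_right_mono\<close>)
  have "norm (q ^ k / x) \<le> 1 * B"
    unfolding divide_inverse norm_mult norm_power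
    by (intro mult_mono power_le_one) (use assms in auto)
  then show "norm (qpoch_inf (q ^ k / x) q) \<le> exp (B / (1 - norm q))"
    by (intro order_trans[OF norm_qpoch_inf_le]) (use assms in \<open>auto intro!: divide_right_mono\<close>)
qed auto

text \<open>The exponents are arbitrary because the telescoping arguments below also need series
  with other exponents than \<open>gnum\<close>.\<close>

lemma summable_gnum:
  assumes "norm q < 1" "\<And>n. n \<le> e n"
  shows "summable (\<lambda>n. q ^ e n * (qpoch_inf (x * q ^ i n) q * qpoch_inf (q ^ j n / x) q))"
  by (rule summable_power_mult_bounded[OF assms])
    (rule norm_qpoch_inf_pair_le[OF assms(1) order.refl order.refl])

lemma gnum_sums:
  assumes "norm q < 1"
  shows "(\<lambda>n. q ^ (n * (n + 1)) * (qpoch_inf (x * q ^ (n + 1)) q * qpoch_inf (q ^ (n + 2) / x) q)) sums gnum x q"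
  unfolding gnum_def by (intro summable_sums summable_gnum assms) auto

lemma gnum_reflect:
  assumes "q \<noteq> 0"
  shows "gnum (q / x) q = gnum x q"
  unfolding gnum_def
proof (intro suminf_cong)
  fix n
  have "q / x * q ^ (n + 1) = q ^ (n + 2) / x" "q ^ (n + 2) / (q / x) = x * q ^ (n + 1)"
    using assms by (auto simp: field_simps)
  then show "q ^ (n * (n + 1)) * (qpoch_inf (q / x * q ^ (n + 1)) q * qpoch_inf (q ^ (n + 2) / (q / x)) q) =
        q ^ (n * (n + 1)) * (qpoch_inf (x * q ^ (n + 1)) q * qpoch_inf (q ^ (n + 2) / x) q)"
    by (simp only: mult_ac)
qed

lemma qtheta_reflect:
  assumes "q \<noteq> 0"
  shows "qtheta (q / x) q = qtheta x q"
  using assms by (simp add: qtheta_def)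

lemma qtheta_shift:
  assumes "norm q < 1" "q \<noteq> 0" "x \<noteq> 0"
  shows "x * qtheta (q * x) q = - qtheta x q"
proof -
  have 1: "qpoch_inf x q = (1 - x) * qpoch_inf (q * x) q"
    using qpoch_inf_rec[OF assms(1), of x] by (simp add: mult.commute)
  have 2: "qpoch_inf (1 / x) q = (1 - 1 / x) * qpoch_inf (q / x) q"
    using qpoch_inf_rec[OF assms(1), of "1/x"] by simp
  have 3: "q / (q * x) = 1 / x"
    using assms by simp
  show ?thesis
    unfolding qtheta_def 1 2 3 using assms by (simp add: field_simps)
qed

text \<open>A telescoping sum. With y = q^(n+1) the terms differ only in the factors 1 - x y and 1 -
  y/x, and (1 - x^2) ((1 - x y) (1 - y/x) - y^2) = (1 - y/x) - x^2 (1 - x y). In \<open>U 0\<close>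
  the part 1 - x of 1 - x^2 completes the products to theta and leaves 1 + x.\<close>

lemma gnum_shift:
  assumes "norm q < 1" "q \<noteq> 0" "x \<noteq> 0"
  shows "gnum (q * x) q = x\<^sup>2 * gnum x q + (1 + x) * qtheta x q"
proof -
  define U where "U n = (1 - x\<^sup>2) * (q ^ (n * (n + 1)) *
    (qpoch_inf (x * q ^ (n + 1)) q * qpoch_inf (q ^ (n + 1) / x) q))" for n
  define S where "S n = q ^ (n * (n + 1)) *
    (qpoch_inf (q * x * q ^ (n + 1)) q * qpoch_inf (q ^ (n + 2) / (q * x)) q)" for n
  define R where "R n = q ^ (n * (n + 1)) *
    (qpoch_inf (x * q ^ (n + 1)) q * qpoch_inf (q ^ (n + 2) / x) q)" for n
  have "U \<longlonglongrightarrow> (1 - x\<^sup>2) * 0"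
    unfolding U_def by (intro tendsto_mult tendsto_const summable_LIMSEQ_zero summable_gnum assms) auto
  then have "(\<lambda>n. U n - U (Suc n)) sums (U 0 - 0)"
    by (intro telescope_sums') simp
  moreover have "U n - U (Suc n) = S n - x\<^sup>2 * R n" for n
  proof -
    define a where "a = qpoch_inf (x * q ^ (n + 2)) q"
    define b where "b = qpoch_inf (q ^ (n + 2) / x) q"
    have 1: "qpoch_inf (x * q ^ (n + 1)) q = (1 - x * q ^ (n + 1)) * a"
      using qpoch_inf_rec[OF assms(1), of "x * q ^ (n + 1)"] by (simp add: a_def mult_ac)
    have 2: "qpoch_inf (q ^ (n + 1) / x) q = (1 - q ^ (n + 1) / x) * b"
      using qpoch_inf_rec[OF assms(1), of "q ^ (n + 1) / x"] by (simp add: b_def mult_ac)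
    have 3: "q * x * q ^ (n + 1) = x * q ^ (n + 2)" "q ^ (n + 2) / (q * x) = q ^ (n + 1) / x"
      using assms by (auto simp: field_simps)
    have 4: "q ^ (Suc n * (Suc n + 1)) = q ^ (n * (n + 1)) * (q ^ (n + 1))\<^sup>2"
    proof -
      have "Suc n * (Suc n + 1) = n * (n + 1) + (n + 1) * 2" by simp
      then show ?thesis by (simp only: power_add power_mult)
    qed
    have U': "U (Suc n) = (1 - x\<^sup>2) * (q ^ (n * (n + 1)) * (q ^ (n + 1))\<^sup>2 * (a * b))"
      unfolding U_def 4 a_def b_def by simp
    define y where "y = q ^ (n + 1)"
    define w where "w = q ^ (n * (n + 1))"
    have "U n = (1 - x\<^sup>2) * (w * ((1 - x * y) * a * ((1 - y / x) * b)))"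
      "S n = w * (a * ((1 - y / x) * b))" "R n = w * ((1 - x * y) * a * b)"
      unfolding U_def S_def R_def 1 2 3 y_def w_def a_def[symmetric] b_def[symmetric] by simp_all
    moreover have "(1 - x\<^sup>2) * (w * ((1 - x * y) * a * ((1 - y / x) * b))) - (1 - x\<^sup>2) * (w * y\<^sup>2 * (a * b))
        = w * (a * ((1 - y / x) * b)) - x\<^sup>2 * (w * ((1 - x * y) * a * b))"
      using assms by (simp add: field_simps power2_eq_square)
    ultimately show ?thesis
      unfolding U' y_def[symmetric] w_def[symmetric] by simp
  qed
  ultimately have "(\<lambda>n. S n - x\<^sup>2 * R n) sums U 0" by simp
  moreover have "(\<lambda>n. S n - x\<^sup>2 * R n) sums (gnum (q * x) q - x\<^sup>2 * gnum x q)"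
    unfolding S_def R_def by (intro sums_diff sums_mult gnum_sums assms)
  ultimately have "U 0 = gnum (q * x) q - x\<^sup>2 * gnum x q"
    using sums_unique2 by blast
  moreover have "U 0 = (1 + x) * qtheta x q"
  proof -
    have "U 0 = (1 + x) * ((1 - x) * qpoch_inf (x * q) q * qpoch_inf (q / x) q)"
      unfolding U_def by (simp add: algebra_simps power2_eq_square)
    then show ?thesis
      unfolding qtheta_def qpoch_inf_rec[OF assms(1), of x, symmetric] .
  qed
  ultimately show ?thesis by (simp add: algebra_simps)
qed

text \<open>Telescoping trades the exponents n^2 of the definition for n (n + 1). The boundary term
  \<open>V 0\<close> is theta itself, which cancels the -1 in \<open>g\<close>; the factor x in
  front of \<open>R\<close> cancels the outer 1/x.\<close>

lemma g_eq_gnum: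
  assumes "norm q < 1" "q \<noteq> 0" "x \<noteq> 0" "qtheta x q \<noteq> 0"
  shows "g x q = gnum x q / qtheta x q"
proof -
  define V where "V n = q ^ (n\<^sup>2) * (qpoch_inf (x * q ^ n) q * qpoch_inf (q ^ (n + 1) / x) q)" for n
  define S where "S n = q ^ (n\<^sup>2) * (qpoch_inf (x * q ^ (n + 1)) q * qpoch_inf (q ^ (n + 1) / x) q)" for n
  define R where "R n = q ^ (n * (n + 1)) *
    (qpoch_inf (x * q ^ (n + 1)) q * qpoch_inf (q ^ (n + 2) / x) q)" for n
  have le: "n \<le> n\<^sup>2" for n :: nat
    by (simp add: power2_eq_square)
  have "V \<longlonglongrightarrow> 0"
    unfolding V_def by (intro summable_LIMSEQ_zero summable_gnum assms le)
  then have "(\<lambda>n. V n - V (Suc n)) sums (V 0 - 0)"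
    by (rule telescope_sums')
  moreover have "V n - V (Suc n) = S n - x * R n" for n
  proof -
    define a where "a = qpoch_inf (x * q ^ (n + 1)) q"
    define b where "b = qpoch_inf (q ^ (n + 2) / x) q"
    have 1: "qpoch_inf (x * q ^ n) q = (1 - x * q ^ n) * a"
      using qpoch_inf_rec[OF assms(1), of "x * q ^ n"] by (simp add: a_def mult_ac)
    have 2: "qpoch_inf (q ^ (n + 1) / x) q = (1 - q * q ^ n / x) * b"
      using qpoch_inf_rec[OF assms(1), of "q ^ (n + 1) / x"] by (simp add: b_def mult_ac)
    have 4: "q ^ ((Suc n)\<^sup>2) = q ^ (n\<^sup>2) * (q * (q ^ n)\<^sup>2)" "q ^ (n * (n + 1)) = q ^ (n\<^sup>2) * q ^ n"
      by (simp_all add: power_add[symmetric] power_mult[symmetric] power_Suc[symmetric] algebra_simps power2_eq_square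
          del: power_Suc)
    have V': "V (Suc n) = q ^ (n\<^sup>2) * (q * (q ^ n)\<^sup>2) * (a * b)"
      unfolding V_def 4 a_def b_def by simp
    show ?thesis
      unfolding V' unfolding V_def S_def R_def 1 2 4 a_def[symmetric] b_def[symmetric]
      using assms by (simp add: field_simps power2_eq_square)
  qed
  ultimately have "(\<lambda>n. S n - x * R n) sums qtheta x q"
    by (simp add: V_def qtheta_def)
  moreover have "R sums gnum x q"
    unfolding R_def by (rule gnum_sums[OF assms(1)])
  ultimately have "(\<lambda>n. S n - x * R n + x * R n) sums (qtheta x q + x * gnum x q)"
    by (intro sums_add sums_mult)
  then have "(\<lambda>n. S n / qtheta x q) sums ((qtheta x q + x * gnum x q) / qtheta x q)"
    by (intro sums_divide) simp
  moreover have "S n / qtheta x q = q ^ (n\<^sup>2) / (qpoch x q (n + 1) * qpoch (q / x) q n)" for n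
  proof -
    have th: "qtheta x q = (qpoch x q (n + 1) * qpoch (q / x) q n) *
        (qpoch_inf (x * q ^ (n + 1)) q * qpoch_inf (q ^ (n + 1) / x) q)"
      using qpoch_inf_split[OF assms(1), of x "n + 1"] qpoch_inf_split[OF assms(1), of "q / x" n]
      by (simp add: qtheta_def mult_ac)
    then have "qpoch_inf (x * q ^ (n + 1)) q * qpoch_inf (q ^ (n + 1) / x) q \<noteq> 0"
      using assms(4) by auto
    then show ?thesis
      unfolding S_def th by (metis nonzero_mult_divide_mult_cancel_right)
  qed
  ultimately have "(\<Sum>n. q ^ (n\<^sup>2) / (qpoch x q (n + 1) * qpoch (q / x) q n))
      = (qtheta x q + x * gnum x q) / qtheta x q"
    by (simp add: sums_iff)
  then show ?thesis
    unfolding g_def using assms by (simp add: field_simps)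
qed

lemma gnum_holomorphic:
  assumes "norm q < 1"
  shows "(\<lambda>x. gnum x q) holomorphic_on - {0}"
proof (rule holomorphic_uniform_sequence[where f = "\<lambda>N x. \<Sum>n<N. q ^ (n * (n + 1)) *
    (qpoch_inf (x * q ^ (n + 1)) q * qpoch_inf (q ^ (n + 2) / x) q)"])
  show "(\<lambda>x. \<Sum>n<N. q ^ (n * (n + 1)) * (qpoch_inf (x * q ^ (n + 1)) q * qpoch_inf (q ^ (n + 2) / x) q))
      holomorphic_on - {0}" for N
    by (intro holomorphic_intros assms) auto
next
  fix x :: complex assume "x \<in> - {0}"
  then have x: "norm x > 0" by simp
  \<comment> \<open>Half the distance to 0, so that 1/y stays bounded on the ball.\<close>
  define d where "d = norm x / 2"
  have lower: "norm y \<ge> d" and upper: "norm y \<le> norm x + d" if "y \<in> cball x d" for y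
    using that norm_triangle_ineq2[of x y] norm_triangle_ineq2[of y x]
    by (auto simp: dist_norm d_def norm_minus_commute)
  have "uniform_limit (cball x d) (\<lambda>N x. \<Sum>n<N. q ^ (n * (n + 1)) *
    (qpoch_inf (x * q ^ (n + 1)) q * qpoch_inf (q ^ (n + 2) / x) q)) (\<lambda>x. gnum x q) sequentially"
    unfolding gnum_def
  proof (rule Weierstrass_m_test)
    define B where "B = exp ((norm x + d) / (1 - norm q)) * exp (inverse d / (1 - norm q))"
    fix n y assume y: "y \<in> cball x d"
    have "norm (inverse y) \<le> inverse d"
      unfolding norm_inverse using lower[OF y] x by (intro le_imp_inverse_le) (auto simp: d_def)
    then show "norm (q ^ (n * (n + 1)) * (qpoch_inf (y * q ^ (n + 1)) q * qpoch_inf (q ^ (n + 2) / y) q)) \<le> B * norm q ^ n"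
      unfolding B_def
      by (intro norm_power_mult_le norm_qpoch_inf_pair_le assms upper y) auto
  qed (use assms in \<open>auto intro!: summable_mult summable_geometric\<close>)
  moreover have "cball x d \<subseteq> - {0}"
    using lower x by (auto simp: d_def)
  ultimately show "\<exists>d>0. cball x d \<subseteq> - {0} \<and> uniform_limit (cball x d) (\<lambda>N x. \<Sum>n<N. q ^ (n * (n + 1)) *
    (qpoch_inf (x * q ^ (n + 1)) q * qpoch_inf (q ^ (n + 2) / x) q)) (\<lambda>x. gnum x q) sequentially"
    using x by (intro exI[of _ d]) (auto simp: d_def)
qed auto

lemma holomorphic_on_gnum [holomorphic_intros]:
  assumes "norm q < 1" "f holomorphic_on S" "\<And>x. x \<in> S \<Longrightarrow> f x \<noteq> 0"
  shows "(\<lambda>x. gnum (f x) q) holomorphic_on S"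
proof -
  have "f ` S \<subseteq> - {0}"
    using assms(3) by auto
  then show ?thesis
    using holomorphic_on_compose_gen[OF assms(2) gnum_holomorphic[OF assms(1)]] by (simp add: o_def)
qed

lemma holomorphic_on_qtheta [holomorphic_intros]:
  assumes "norm q < 1" "f holomorphic_on S" "\<And>x. x \<in> S \<Longrightarrow> f x \<noteq> 0"
  shows "(\<lambda>x. qtheta (f x) q) holomorphic_on S"
  unfolding qtheta_def by (intro holomorphic_intros assms)

text \<open>This is Cauchy's identity \<open>\<Sum>n. q\<^bsup>n\<^sup>2\<^esup> z\<^sup>n / ((q; q)\<^sub>n (z q; q)\<^sub>n) = 1 / (z q; q)\<^sub>\<infinity>\<close> at \<open>z = q\<close>: multiplied by the two infinite
  products, the left-hand side is invariant under \<open>z \<mapsto> z q\<close> by telescoping, so one may let \<open>z\<close> tend to 0 along powers of \<open>q\<close>.\<close>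

lemma gnum_one:
  assumes "norm q < 1"
  shows "gnum 1 q = qpoch_inf q q"
proof -
  \<comment> \<open>The n-th term of Cauchy's series at z = q^k, times (q; q)_inf and (z q; q)_inf;
    the case k = 1 is \<open>gnum 1 q\<close>.\<close>
  define t where "t k n = q ^ (n\<^sup>2 + k * n) * (qpoch_inf (1 * q ^ (n + k + 1)) q * qpoch_inf (q ^ (n + 1) / 1) q)" for k n :: nat
  have le: "n \<le> n\<^sup>2 + m" for n m :: nat
    by (simp add: power2_eq_square trans_le_add1)
  have summ: "summable (t k)" for k
    unfolding t_def by (intro summable_gnum assms le)
  have step: "suminf (t (Suc k)) = suminf (t k)" for k
  proof -
    define V where "V n = q ^ (n\<^sup>2 + k * n) * (qpoch_inf (1 * q ^ (n + k + 1)) q * qpoch_inf (q ^ n / 1) q)" for n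
    have "V \<longlonglongrightarrow> 0"
      unfolding V_def by (intro summable_LIMSEQ_zero summable_gnum assms le)
    then have "(\<lambda>n. V n - V (Suc n)) sums (V 0 - 0)"
      by (rule telescope_sums')
    moreover have "V 0 = 0"
      by (simp add: V_def qpoch_inf_one assms)
    moreover have "V n - V (Suc n) = t k n - t (Suc k) n" for n
    proof -
      define a where "a = qpoch_inf (q ^ (n + k + 2)) q"
      define b where "b = qpoch_inf (q ^ (n + 1)) q"
      have 1: "qpoch_inf (q ^ (n + k + 1)) q = (1 - q ^ (n + k + 1)) * a"
        using qpoch_inf_rec[OF assms(1), of "q ^ (n + k + 1)"] by (simp add: a_def mult_ac)
      have 2: "qpoch_inf (q ^ n) q = (1 - q ^ n) * b"
        using qpoch_inf_rec[OF assms(1), of "q ^ n"] by (simp add: b_def mult_ac)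
      have V': "V (Suc n) = q ^ (n\<^sup>2 + k * n) * q ^ (2 * n + k + 1) * (a * b)"
      proof -
        have "(Suc n)\<^sup>2 + k * Suc n = (n\<^sup>2 + k * n) + (2 * n + k + 1)"
          by (simp add: power2_eq_square)
        then show ?thesis
          unfolding V_def a_def b_def by (simp only: power_add[of q "n\<^sup>2 + k * n"]) simp
      qed
      have t': "t (Suc k) n = q ^ (n\<^sup>2 + k * n) * q ^ n * (a * b)"
        unfolding t_def a_def b_def by (simp add: power_add[symmetric] algebra_simps)
      have 3: "q ^ (2 * n + k + 1) = q ^ n * q ^ (n + k + 1)"
        by (simp add: power_add[symmetric] mult_2 add_ac)
      define y where "y = q ^ (n + k + 1)"
      show ?thesis
        unfolding V' t' 3 unfolding V_def t_def mult_1_left div_by_1 1 2 b_def[symmetric]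
        unfolding y_def[symmetric] by algebra
    qed
    ultimately have "(\<lambda>n. t k n - t (Suc k) n) sums 0" by simp
    then show ?thesis
      using suminf_diff[OF summ summ, of k "Suc k"] by (simp add: sums_iff)
  qed
  have const: "suminf (t (Suc k)) = gnum 1 q" for k
  proof (induction k)
    case 0
    have "t (Suc 0) = (\<lambda>n. q ^ (n * (n + 1)) * (qpoch_inf (1 * q ^ (n + 1)) q * qpoch_inf (q ^ (n + 2) / 1) q))"
    proof
      fix n :: nat
      have "n\<^sup>2 + Suc 0 * n = n * (n + 1)" "n + Suc 0 + 1 = n + 2"
        by (simp_all add: power2_eq_square)
      then show "t (Suc 0) n = q ^ (n * (n + 1)) * (qpoch_inf (1 * q ^ (n + 1)) q * qpoch_inf (q ^ (n + 2) / 1) q)"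
        by (simp only: t_def mult_1_left div_by_1 mult.commute)
    qed
    then show ?case by (simp add: gnum_def)
  next
    case (Suc k)
    then show ?case by (simp only: step[of "Suc k"])
  qed
  define B where "B = exp (1 / (1 - norm q)) * exp (1 / (1 - norm q))"
  \<comment> \<open>Every term after the first carries at least the power q^k, so only the term n =
    0 survives as k grows.\<close>
  have bound: "norm (suminf (t k) - qpoch_inf (q ^ (k + 1)) q * qpoch_inf q q) \<le> norm q ^ k * (B / (1 - norm q))" for k
  proof -
    have "suminf (t k) - t k 0 = (\<Sum>n. t k (Suc n))"
      using suminf_split_head[OF summ] by simp
    also have "norm \<dots> \<le> (\<Sum>n. (norm q ^ k * B) * norm q ^ n)"
    proof (rule norm_suminf_le)
      fix n
      have "norm (t k (Suc n)) \<le> B * norm q ^ (k + n)"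
        unfolding t_def B_def
        by (intro norm_power_mult_le norm_qpoch_inf_pair_le assms)
          (auto simp: power2_eq_square)
      then show "norm (t k (Suc n)) \<le> (norm q ^ k * B) * norm q ^ n"
        by (simp add: power_add mult_ac)
    qed (use assms in \<open>auto intro!: summable_mult summable_geometric\<close>)
    also have "\<dots> = norm q ^ k * (B / (1 - norm q))"
      using assms by (subst suminf_mult) (auto intro!: summable_geometric simp: suminf_geometric)
    finally show ?thesis
      by (simp add: t_def)
  qed
  have "(\<lambda>k. norm q ^ k * (B / (1 - norm q))) \<longlonglongrightarrow> 0 * (B / (1 - norm q))"
    using assms by (intro tendsto_mult tendsto_const LIMSEQ_power_zero) simp
  then have "(\<lambda>k. norm q ^ k * (B / (1 - norm q))) \<longlonglongrightarrow> 0"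
    by simp
  then have "(\<lambda>k. suminf (t k) - qpoch_inf (q ^ (k + 1)) q * qpoch_inf q q) \<longlonglongrightarrow> 0"
    by (rule Lim_null_comparison[OF always_eventually[OF allI[OF bound]]])
  moreover have "(\<lambda>k. qpoch_inf (q ^ (k + 1)) q * qpoch_inf q q) \<longlonglongrightarrow> qpoch_inf 0 q * qpoch_inf q q"
    using LIMSEQ_ignore_initial_segment[OF LIMSEQ_power_zero[OF assms], of 1]
    by (intro tendsto_mult tendsto_const qpoch_inf_tendsto assms)
  ultimately have "(\<lambda>k. suminf (t k) - qpoch_inf (q ^ (k + 1)) q * qpoch_inf q q + qpoch_inf (q ^ (k + 1)) q * qpoch_inf q q)
      \<longlonglongrightarrow> 0 + qpoch_inf 0 q * qpoch_inf q q"
    by (rule tendsto_add)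
  then have "(\<lambda>k. suminf (t k)) \<longlonglongrightarrow> qpoch_inf q q"
    by simp
  from LIMSEQ_Suc[OF this] have "(\<lambda>k. suminf (t (Suc k))) \<longlonglongrightarrow> qpoch_inf q q" .
  then show ?thesis
    unfolding const by (simp add: LIMSEQ_const_iff)
qed

section \<open>Functions invariant under multiplication by q\<close>

text \<open>The annulus |q| < |x| < 1/|q|. It is wide enough to contain a closed fundamental annulus
  for x \<mapsto> q x in its interior, and narrow enough that 1 is the only integer power of q in
  it.\<close>

definition qannulus :: "complex \<Rightarrow> complex set" where
  "qannulus q = {x. norm q < norm x \<and> norm (q * x) < 1}"

lemma open_qannulus: "open (qannulus q)"
  unfolding qannulus_def by (intro open_Collect_conj open_Collect_less continuous_intros)

lemma connected_qannulus:
  assumes "q \<noteq> 0"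
  shows "connected (qannulus q)"
proof -
  have "qannulus q = {x. norm q < norm (x - 0) \<and> norm (x - 0) < 1 / norm q}"
    using assms by (auto simp: qannulus_def norm_mult field_simps)
  then show ?thesis
    using connected_annulus(1)[where a = "0 :: complex" and ?r1.0 = "norm q" and ?r2.0 = "1 / norm q"] by simp
qed

lemma qannulus_nonzero: "x \<in> qannulus q \<Longrightarrow> x \<noteq> 0"
  by (auto simp: qannulus_def)

text \<open>The annulus is not invariant, but the compact set \<open>K\<close> between sqrt |q| and
  its inverse can be reached from each of its points by at most one multiplication or division by q.
  A maximum of |f| on \<open>K\<close> is thus a maximum on the whole open annulus.\<close>

lemma q_periodic_constant:
  assumes q: "q \<noteq> 0" "norm q < 1"
    and hol: "f holomorphic_on qannulus q"
    and per: "\<And>x. x \<in> qannulus q \<Longrightarrow> q * x \<in> qannulus q \<Longrightarrow> f (q * x) = f x"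
    and xy: "x \<in> qannulus q" "y \<in> qannulus q"
  shows "f x = f y"
proof -
  define s where "s = sqrt (norm q)"
  have s: "0 < s" "s < 1" "s * s = norm q"
    using q by (auto simp: s_def)
  have s2: "norm q < s" "norm q * (1 / s) = s"
    using s mult_strict_left_mono[of s 1 s] by (auto simp: field_simps)
  define K where "K = cball 0 (1 / s) \<inter> {x::complex. s \<le> norm x}"
  have "compact K"
    unfolding K_def by (intro compact_Int_closed compact_cball closed_Collect_le continuous_intros)
  have KA: "K \<subseteq> qannulus q"
  proof
    fix z assume z: "z \<in> K"
    have "norm q * norm z \<le> norm q * (1 / s)"
      using z by (intro mult_left_mono) (auto simp: K_def)
    then show "z \<in> qannulus q"
      using z s s2 by (auto simp: K_def qannulus_def norm_mult)
  qed
  have "1 \<in> K"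
    using s by (auto simp: K_def)
  moreover have "continuous_on K (\<lambda>x. norm (f x))"
    using hol KA by (intro continuous_on_norm) (meson continuous_on_subset holomorphic_on_imp_continuous_on)
  ultimately obtain w where w: "w \<in> K" "\<And>z. z \<in> K \<Longrightarrow> norm (f z) \<le> norm (f w)"
    using continuous_attains_sup[OF \<open>compact K\<close>] by blast
  have "norm (f z) \<le> norm (f w)" if z: "z \<in> qannulus q" for z
  proof -
    \<comment> \<open>Below \<open>K\<close> division by q gives a norm between 1 and 1/s, above
      \<open>K\<close> multiplication by q gives a norm between s and 1, because s^2 = |q|.\<close>
    consider "norm z < s" | "z \<in> K" | "norm z > 1 / s"
      unfolding K_def by fastforce
    then show ?thesis
    proof cases
      case 1
      have "norm (z / q) \<ge> 1"
        using z q by (simp add: qannulus_def norm_divide field_simps)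
      moreover have "norm (z / q) \<le> 1 / s"
        using 1 s q by (simp add: norm_divide field_simps flip: s(3))
      ultimately have "z / q \<in> K"
        using s by (auto simp: K_def)
      moreover have "f (q * (z / q)) = f (z / q)"
        using \<open>z / q \<in> K\<close> KA z q by (intro per) auto
      ultimately show ?thesis
        using w(2)[of "z / q"] q by simp
    next
      case 3
      have "norm (q * z) \<le> 1"
        using z by (simp add: qannulus_def)
      moreover have "norm (q * z) \<ge> s"
        using 3 s by (simp add: norm_mult field_simps flip: s(3))
      moreover have "1 \<le> 1 / s"
        using s by simp
      ultimately have "q * z \<in> K"
        unfolding K_def by auto
      moreover have "f (q * z) = f z"
        using \<open>q * z \<in> K\<close> KA z by (intro per) auto
      ultimately show ?thesis
        using w(2)[of "q * z"] by simp
    qed (use w in auto)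
  qed
  then have "f constant_on qannulus q"
    by (intro maximum_modulus_principle[OF hol open_qannulus connected_qannulus[OF q(1)] open_qannulus[of q], of w])
      (use w KA in auto)
  then show ?thesis
    using xy unfolding constant_on_def by metis
qed

section \<open>Dissections of theta functions and of g\<close>

lemma J_nonzero:
  assumes "norm q < 1" "m > 0"
  shows "J m q \<noteq> 0"
  unfolding J_def using norm_power_lt_1[OF assms] by (intro qpoch_inf_nonzero')

lemma J_power: "J m (q ^ k) = J (k * m) q"
  by (simp add: J_def power_mult)

lemma qpoch_inf_minus_J:
  assumes "norm q < 1"
  shows "qpoch_inf (- q) q = J 2 q / J 1 q"
  using qpoch_inf_mult_minus[OF assms, of q] J_nonzero[OF assms, of 1]
  by (simp add: J_def field_simps)

lemma qpoch_inf_odd_J: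
  assumes "norm q < 1"
  shows "qpoch_inf q (q\<^sup>2) = J 1 q / J 2 q"
  using qpoch_inf_even_odd[OF assms, of q] J_nonzero[OF assms, of 2]
  by (simp add: J_def field_simps power2_eq_square)

lemma qpoch_inf_minus_odd_J:
  assumes "norm q < 1"
  shows "qpoch_inf (- q) (q\<^sup>2) = J 2 q ^ 2 / (J 1 q * J 4 q)"
proof -
  have "norm (q\<^sup>2) < 1"
    using norm_power_lt_1[OF assms] by simp
  then have "qpoch_inf (- (q\<^sup>2)) (q\<^sup>2) = J 4 q / J 2 q"
    using qpoch_inf_minus_J[of "q\<^sup>2"] by (simp add: J_power)
  then show ?thesis
    using qpoch_inf_even_odd[OF assms, of "- q"] qpoch_inf_minus_J[OF assms]
      J_nonzero[OF assms, of 1] J_nonzero[OF assms, of 2] J_nonzero[OF assms, of 4]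
    by (simp add: field_simps power2_eq_square)
qed

lemma qtheta_one:
  assumes "norm q < 1"
  shows "qtheta 1 q = 0"
  using qpoch_inf_one[OF assms] by (simp add: qtheta_def)

text \<open>The exponents 1 and 3 modulo 4 interleave to all odd exponents, so this theta value is
  the single product (-q; q^2)_inf.\<close>

lemma qtheta_minus_quartic:
  assumes "norm q < 1" "q \<noteq> 0"
  shows "qtheta (- q) (q ^ 4) = J 2 q ^ 2 / (J 1 q * J 4 q)"
proof -
  have "norm (q\<^sup>2) < 1"
    using norm_power_lt_1[OF assms(1)] by simp
  from qpoch_inf_even_odd[OF this, of "- q"] show ?thesis
    using assms qpoch_inf_minus_odd_J[OF assms(1)]
    by (simp add: qtheta_def power_mult[symmetric] power_Suc[symmetric] eval_nat_numeral mult_ac)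
qed

text \<open>Isolates the factor responsible for the only zero of theta inside
  \<open>qannulus q\<close>.\<close>

lemma qtheta_factor:
  assumes "norm q < 1"
  shows "qtheta x q = (1 - x) * (qpoch_inf (q * x) q * qpoch_inf (q / x) q)"
  using qpoch_inf_rec[OF assms, of x] by (simp add: qtheta_def mult_ac)

lemma qannulus_factors_nonzero:
  assumes "norm q < 1" "x \<in> qannulus q"
  shows "qpoch_inf (q * x) q \<noteq> 0" "qpoch_inf (q / x) q \<noteq> 0"
proof -
  have "norm (q * x) < 1" "norm (q / x) < 1"
    using assms order.strict_trans1[OF norm_ge_zero, of q "norm x"] by (auto simp: qannulus_def norm_divide)
  then show "qpoch_inf (q * x) q \<noteq> 0" "qpoch_inf (q / x) q \<noteq> 0"
    using qpoch_inf_nonzero'[OF assms(1)] by blast+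
qed

text \<open>In the triple product series this separates even from odd exponents of x. Here it is
  obtained from the products alone: both sides change by the same factor under x \<mapsto> q x, so
  their quotient is constant once the common zero x = 1 is removed.\<close>

lemma qtheta_dissection:
  assumes q: "norm q < 1" "q \<noteq> 0" and x: "x \<in> qannulus q"
  shows "J 1 q * qtheta x q = J 4 q * (qtheta (- q * x\<^sup>2) (q ^ 4) - x * qtheta (- (q ^ 3) * x\<^sup>2) (q ^ 4))"
proof -
  have q4: "norm (q ^ 4) < 1" "q ^ 4 \<noteq> 0"
    using norm_power_lt_1[OF q(1)] q by auto
  define R where "R x = qtheta (- q * x\<^sup>2) (q ^ 4) - x * qtheta (- (q ^ 3) * x\<^sup>2) (q ^ 4)" for x
  define c where "c x = qpoch_inf (q * x) q * qpoch_inf (q / x) q" for x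
  \<comment> \<open>This is -R/theta, extended over x = 1 by the derivative of \<open>R\<close>; it
    is holomorphic there because \<open>R 1 = 0\<close>.\<close>
  define h where "h x = (if x = 1 then deriv R 1 else (R x - R 1) / (x - 1)) / c x" for x
  have R_shift: "x * R (q * x) = - R x" if "x \<noteq> 0" for x
  proof -
    \<comment> \<open>The shift turns the first theta argument into the second, and the second into
      q^4 times the first.\<close>
    have 1: "- q * (q * x)\<^sup>2 = - (q ^ 3) * x\<^sup>2" "- (q ^ 3) * (q * x)\<^sup>2 = q ^ 4 * (- q * x\<^sup>2)"
      by (simp_all add: eval_nat_numeral)
    have 2: "q * x\<^sup>2 * qtheta (q ^ 4 * (- q * x\<^sup>2)) (q ^ 4) = qtheta (- q * x\<^sup>2) (q ^ 4)"
      using qtheta_shift[OF q4, of "- q * x\<^sup>2"] q that by simp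
    show ?thesis
      unfolding R_def 1 using 2 by (simp add: algebra_simps power2_eq_square)
  qed
  have R1: "R 1 = 0"
    using qtheta_reflect[OF q4(2), of "- q"] q by (simp add: R_def eval_nat_numeral)
  have nz: "c x \<noteq> 0" if "x \<in> qannulus q" for x
    using qannulus_factors_nonzero[OF q(1) that] by (simp add: c_def)
  have theta: "qtheta x q = (1 - x) * c x" for x
    unfolding c_def by (rule qtheta_factor[OF q(1)])
  have h_eq: "h x = - R x / qtheta x q" if "x \<in> qannulus q" "x \<noteq> 1" for x
    using that nz[OF that(1)] unfolding h_def R1 theta by (simp add: field_simps)
  have "R holomorphic_on qannulus q"
    unfolding R_def using q q4 by (intro holomorphic_intros) (auto dest: qannulus_nonzero)
  then have "h holomorphic_on qannulus q"
    unfolding h_def c_def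
    by (intro holomorphic_on_divide pole_lemma_open open_qannulus holomorphic_intros q)
      (use nz in \<open>auto dest: qannulus_nonzero simp: c_def\<close>)
  moreover have "h (q * z) = h z" if z: "z \<in> qannulus q" "q * z \<in> qannulus q" for z
  proof -
    have ne: "z \<noteq> 1" "q * z \<noteq> 1"
      using z by (auto simp: qannulus_def)
    have "z \<noteq> 0"
      using qannulus_nonzero z by blast
    have "h (q * z) = - (z * R (q * z)) / (z * qtheta (q * z) q)"
      using h_eq[OF z(2) ne(2)] \<open>z \<noteq> 0\<close> by simp
    also have "\<dots> = h z"
      unfolding R_shift[OF \<open>z \<noteq> 0\<close>] qtheta_shift[OF q \<open>z \<noteq> 0\<close>] h_eq[OF z(1) ne(1)] by simp
    finally show ?thesis .
  qed
  \<comment> \<open>At x = 1 both sides vanish, so the constant is read off at x = -1, where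
    reflection makes the two theta terms equal and all values are products.\<close>
  moreover have m1: "-1 \<in> qannulus q"
    using q by (auto simp: qannulus_def)
  ultimately have const: "h x = h (-1)"
    using q_periodic_constant q x by blast
  have Rx: "J 4 q * R x = J 1 q * qtheta x q"
  proof (cases "x = 1")
    case False
    have th: "qtheta x q \<noteq> 0"
      unfolding theta using nz[OF x] False by simp
    have thm1: "qtheta (-1) q = 2 * (J 2 q / J 1 q)\<^sup>2"
      using qpoch_inf_rec[OF q(1), of "-1"] qpoch_inf_minus_J[OF q(1)]
      by (simp add: qtheta_def power2_eq_square)
    have "R (-1) = 2 * (J 2 q ^ 2 / (J 1 q * J 4 q))"
      using qtheta_reflect[OF q4(2), of "- q"] qtheta_minus_quartic[OF q] q
      by (simp add: R_def eval_nat_numeral)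
    moreover have "R x / qtheta x q = R (-1) / qtheta (-1) q"
      using const h_eq[OF x False] h_eq[OF m1] by simp
    ultimately have "R x / qtheta x q = J 1 q / J 4 q"
      using J_nonzero[OF q(1), of 1] J_nonzero[OF q(1), of 2] J_nonzero[OF q(1), of 4] thm1
      by (simp add: power2_eq_square)
    then show ?thesis
      using th J_nonzero[OF q(1), of 4] by (simp add: field_simps)
  qed (simp add: R1 theta)
  then show ?thesis
    unfolding R_def by simp
qed

section \<open>The dissection of \<open>g\<close> and its values at q and i q in base q^2\<close>

lemma qtheta_square:
  assumes "norm q < 1" "q \<noteq> 0"
  shows "qtheta q (q\<^sup>2) = (J 1 q / J 2 q)\<^sup>2"
  using qpoch_inf_odd_J[OF assms(1)] assms by (simp add: qtheta_def power2_eq_square)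

lemma qtheta_minus_square:
  assumes "norm q < 1" "q \<noteq> 0"
  shows "qtheta (- q) (q\<^sup>2) = (J 2 q ^ 2 / (J 1 q * J 4 q))\<^sup>2"
proof -
  have "q\<^sup>2 / (- q) = - q"
    using assms by (simp add: power2_eq_square)
  then show ?thesis
    using qpoch_inf_minus_odd_J[OF assms(1)] by (simp add: qtheta_def power2_eq_square[of "_ / _"])
qed

text \<open>The shift exchanges -q x^2 and -q/x^2 up to a reflection and one shift in base q^4,
  which is why both g-terms must occur. The inhomogeneous terms of \<open>gnum_shift\<close>, from
  \<open>gnum x q\<close> and from \<open>B\<close>, combine with the shifted summand
  \<open>a x * b x\<close> to reproduce that summand; this is the origin of -1/x in the
  identity.\<close>

lemma gnum_dissection:
  assumes q: "norm q < 1" "q \<noteq> 0" and x: "x \<in> qannulus q"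
  defines "a \<equiv> \<lambda>x. qtheta (- q * x\<^sup>2) (q ^ 4)" and "b \<equiv> \<lambda>x. qtheta (- q / x\<^sup>2) (q ^ 4)"
    and "A \<equiv> \<lambda>x. gnum (- q * x\<^sup>2) (q ^ 4)" and "B \<equiv> \<lambda>x. gnum (- q / x\<^sup>2) (q ^ 4)"
  shows "x * (a x * b x) * gnum x q + qtheta x q * (a x * b x - q / x\<^sup>2 * a x * B x + q * x * b x * A x)
    = J 2 q ^ 4 / (J 1 q * J 4 q ^ 2)"
proof -
  have q4: "norm (q ^ 4) < 1" "q ^ 4 \<noteq> 0"
    using norm_power_lt_1[OF q(1)] q by auto
  define F where "F x = x * (a x * b x) * gnum x q +
    qtheta x q * (a x * b x - q / x\<^sup>2 * a x * B x + q * x * b x * A x)" for x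
  have per: "F (q * x) = F x" if "x \<noteq> 0" for x
  proof -
    have 1: "- q * (q * x)\<^sup>2 = q ^ 4 / (- q / x\<^sup>2)" "- q / (q * x)\<^sup>2 = q ^ 4 / (q ^ 4 * (- q * x\<^sup>2))"
      using q that by (simp_all add: field_simps power_numeral_reduce)
    have y: "- q * x\<^sup>2 \<noteq> 0"
      using q that by simp
    have shifts: "a (q * x) = b x" "A (q * x) = B x"
      "b (q * x) = qtheta (q ^ 4 * (- q * x\<^sup>2)) (q ^ 4)" "B (q * x) = gnum (q ^ 4 * (- q * x\<^sup>2)) (q ^ 4)"
      unfolding a_def b_def A_def B_def 1 by (rule qtheta_reflect[OF q4(2)] gnum_reflect[OF q4(2)])+
    have b': "b (q * x) = a x / (q * x\<^sup>2)"
      unfolding shifts using qtheta_shift[OF q4 y] y q that by (simp add: a_def field_simps)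
    have B': "B (q * x) = (q * x\<^sup>2)\<^sup>2 * A x + (1 - q * x\<^sup>2) * a x"
      unfolding shifts gnum_shift[OF q4 y] A_def a_def by simp
    have th: "qtheta (q * x) q = - qtheta x q / x"
      using qtheta_shift[OF q that] that by (simp add: field_simps)
    show ?thesis
      unfolding F_def b' B' th shifts(1,2) gnum_shift[OF q that]
      using q that by (simp add: field_simps) algebra
  qed
  have "F holomorphic_on qannulus q"
    unfolding F_def a_def b_def A_def B_def using q q4
    by (intro holomorphic_intros) (auto dest: qannulus_nonzero)
  moreover have "1 \<in> qannulus q"
    using q by (auto simp: qannulus_def)
  ultimately have "F x = F 1"
    using q_periodic_constant[OF q(2,1)] x per qannulus_nonzero by metis
  \<comment> \<open>Since theta(1; q) = 0, the whole second summand drops out. What remains is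
    \<open>gnum 1 q\<close>, which is J_1, times the square of theta(-q; q^4).\<close>
  also have "F 1 = J 2 q ^ 4 / (J 1 q * J 4 q ^ 2)"
    using J_nonzero[OF q(1), of 1] J_nonzero[OF q(1), of 2] J_nonzero[OF q(1), of 4]
    by (simp add: F_def a_def b_def qtheta_one[OF q(1)] qtheta_minus_quartic[OF q] gnum_one[OF q(1)])
      (simp add: J_def field_simps power_numeral_reduce)
  finally show ?thesis
    unfolding F_def .
qed

text \<open>\<open>gnum_dissection\<close> in base q^2 at x = q. There -q^2/x^2 = -1, and the three
  theta values are nonzero quotients of \<open>J\<close>, so that one may divide by them.\<close>

lemma g_odd_dissection:
  assumes q: "norm q < 1" "q \<noteq> 0"
  shows "g q (q\<^sup>2) = - (1 / q) + g (-1) (q ^ 8) / q - q\<^sup>2 * g (- (q ^ 4)) (q ^ 8)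
    + J 2 q * J 4 q ^ 6 / (2 * q * J 8 q ^ 4 * J 1 q ^ 2)"
proof -
  have q2: "norm (q\<^sup>2) < 1" "q\<^sup>2 \<noteq> 0" and q4: "norm (q ^ 4) < 1" and q8: "norm (q ^ 8) < 1" "q ^ 8 \<noteq> 0"
    using norm_power_lt_1[OF q(1)] q by auto
  have x: "q \<in> qannulus (q\<^sup>2)"
    using q norm_power_lt_1[OF q(1), of 3] mult_strict_left_mono[OF q(1), of "norm q"]
    by (auto simp: qannulus_def norm_power norm_mult power2_eq_square power_numeral_reduce)
  have nz: "J 1 q \<noteq> 0" "J 2 q \<noteq> 0" "J 4 q \<noteq> 0" "J 8 q \<noteq> 0" "J 16 q \<noteq> 0"
    using J_nonzero[OF q(1)] by auto
  have th: "qtheta q (q\<^sup>2) = (J 1 q / J 2 q)\<^sup>2"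
    by (rule qtheta_square[OF q])
  have tha: "qtheta (- (q ^ 4)) (q ^ 8) = (J 8 q ^ 2 / (J 4 q * J 16 q))\<^sup>2"
    using qtheta_minus_square[OF q4] q by (simp add: J_power power_mult[symmetric])
  have thb: "qtheta (- 1) (q ^ 8) = 2 * (J 16 q / J 8 q)\<^sup>2"
    using qpoch_inf_minus_J[OF q8(1)] qpoch_inf_rec[OF q8(1), of "-1"]
    by (simp add: qtheta_def J_power power2_eq_square)
  have args: "- (q\<^sup>2) * q\<^sup>2 = - (q ^ 4)" "- (q\<^sup>2) / q\<^sup>2 = - 1" "(q\<^sup>2) ^ 4 = q ^ 8" "q\<^sup>2 * q = q ^ 3"
    using q by (auto simp: power_numeral_reduce)
  have Jp: "J m (q\<^sup>2) = J (2 * m) q" for m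
    by (rule J_power)
  have eq: "q * (qtheta (- (q ^ 4)) (q ^ 8) * qtheta (- 1) (q ^ 8)) * gnum q (q\<^sup>2) +
      qtheta q (q\<^sup>2) * (qtheta (- (q ^ 4)) (q ^ 8) * qtheta (- 1) (q ^ 8)
        - qtheta (- (q ^ 4)) (q ^ 8) * gnum (- 1) (q ^ 8)
        + q ^ 3 * qtheta (- 1) (q ^ 8) * gnum (- (q ^ 4)) (q ^ 8)) = J 4 q ^ 4 / (J 2 q * J 8 q ^ 2)"
    using gnum_dissection[OF q2 x] unfolding args Jp using q by simp
  have tnz: "qtheta q (q\<^sup>2) \<noteq> 0" "qtheta (- (q ^ 4)) (q ^ 8) \<noteq> 0" "qtheta (- 1) (q ^ 8) \<noteq> 0"
    unfolding th tha thb using nz by auto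
  have gs: "gnum q (q\<^sup>2) = g q (q\<^sup>2) * qtheta q (q\<^sup>2)"
    "gnum (- (q ^ 4)) (q ^ 8) = g (- (q ^ 4)) (q ^ 8) * qtheta (- (q ^ 4)) (q ^ 8)"
    "gnum (- 1) (q ^ 8) = g (- 1) (q ^ 8) * qtheta (- 1) (q ^ 8)"
    using g_eq_gnum[OF q2 q(2) tnz(1)] g_eq_gnum[OF q8 _ tnz(2)] g_eq_gnum[OF q8 _ tnz(3)] tnz q by auto
  have "qtheta q (q\<^sup>2) * qtheta (- (q ^ 4)) (q ^ 8) * qtheta (- 1) (q ^ 8) *
      (q * g q (q\<^sup>2) + 1 - g (- 1) (q ^ 8) + q ^ 3 * g (- (q ^ 4)) (q ^ 8)) = J 4 q ^ 4 / (J 2 q * J 8 q ^ 2)"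
    using eq unfolding gs by (simp only: algebra_simps mult_1_left)
  moreover have "qtheta q (q\<^sup>2) * qtheta (- (q ^ 4)) (q ^ 8) * qtheta (- 1) (q ^ 8)
      = 2 * J 1 q ^ 2 * J 8 q ^ 2 / (J 2 q ^ 2 * J 4 q ^ 2)"
    unfolding th tha thb using nz by (simp add: field_simps power_numeral_reduce)
  moreover have "J 4 q ^ 4 / (J 2 q * J 8 q ^ 2) = 2 * J 1 q ^ 2 * J 8 q ^ 2 / (J 2 q ^ 2 * J 4 q ^ 2) *
      (J 2 q * J 4 q ^ 6 / (2 * J 8 q ^ 4 * J 1 q ^ 2))"
    using nz by (simp add: field_simps power_numeral_reduce)
  ultimately have "q * g q (q\<^sup>2) + 1 - g (- 1) (q ^ 8) + q ^ 3 * g (- (q ^ 4)) (q ^ 8)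
      = J 2 q * J 4 q ^ 6 / (2 * J 8 q ^ 4 * J 1 q ^ 2)"
    using nz by (simp only: mult_cancel_left) simp
  then have "q * g q (q\<^sup>2) = - 1 + g (- 1) (q ^ 8) - q ^ 3 * g (- (q ^ 4)) (q ^ 8)
      + J 2 q * J 4 q ^ 6 / (2 * J 8 q ^ 4 * J 1 q ^ 2)"
    by (simp add: algebra_simps)
  then have "g q (q\<^sup>2) = (- 1 + g (- 1) (q ^ 8) - q ^ 3 * g (- (q ^ 4)) (q ^ 8)
      + J 2 q * J 4 q ^ 6 / (2 * J 8 q ^ 4 * J 1 q ^ 2)) / q"
    using q by (simp add: field_simps)
  then show ?thesis
    using q by (simp add: add_divide_distrib diff_divide_distrib power_numeral_reduce mult_ac)
qed

text \<open>In \<open>\<theta>(- z) F(z) - \<theta>(z) F(- z)\<close>, where \<open>F\<close> is the constant of \<open>gnum_dissection\<close>, everything is divisible by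
  \<open>\<theta>(- q/z\<^sup>2; q\<^sup>4)\<close>, which vanishes at \<open>z = x\<close>; so the division is done for \<open>z \<noteq> \<plusminus> x\<close> and followed by \<open>z \<rightarrow> x\<close>.\<close>

lemma gnum_dissection_even:
  assumes q: "norm q < 1" "q \<noteq> 0" and x: "x\<^sup>2 = - q"
  shows "qtheta (q\<^sup>2) (q ^ 4) * (qtheta (- x) q * gnum x q + qtheta x q * gnum (- x) q)
    + 2 * q * qtheta x q * qtheta (- x) q * gnum (q\<^sup>2) (q ^ 4) = 2 * J 2 q ^ 4 / (J 1 q ^ 2 * J 4 q)"
proof -
  have q4: "norm (q ^ 4) < 1" "q ^ 4 \<noteq> 0"
    using norm_power_lt_1[OF q(1)] q by auto
  have nz: "J 1 q \<noteq> 0" "J 2 q \<noteq> 0" "J 4 q \<noteq> 0"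
    using J_nonzero[OF q(1)] by auto
  define K where "K z = qtheta (- q * z\<^sup>2) (q ^ 4) * (qtheta (- z) q * gnum z q + qtheta z q * gnum (- z) q)
    + 2 * q * qtheta z q * qtheta (- z) q * gnum (- q * z\<^sup>2) (q ^ 4) - 2 * J 2 q ^ 4 / (J 1 q ^ 2 * J 4 q)" for z
  \<comment> \<open>This is theta(-q/z^2; q^4) without its factor 1 + q/z^2, the only one that
    vanishes at z = x. At z = x it equals the square of (q^4; q^4)_inf.\<close>
  define c where "c z = qpoch_inf (q ^ 4 * (- q / z\<^sup>2)) (q ^ 4) * qpoch_inf (q ^ 4 / (- q / z\<^sup>2)) (q ^ 4)" for z
  have normx: "norm x * norm x = norm q"
    using arg_cong[OF x, of norm] by (simp add: norm_mult power2_eq_square)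
  have "norm x > 0" 
    using x q by auto
  have "norm x < 1"
  proof (rule ccontr)
    assume "\<not> norm x < 1"
    then have "1 * 1 \<le> norm x * norm x" by (intro mult_mono) auto
    then show False using normx q by simp
  qed
  have xA: "x \<in> qannulus q"
    using \<open>norm x < 1\<close> \<open>norm x > 0\<close> mult_strict_left_mono[of "norm x" 1 "norm x"]
      mult_strict_mono[of "norm q" 1 "norm x" 1] q normx
    by (auto simp: qannulus_def norm_mult)
  have zero: "c z * K z = 0" if z: "z \<in> qannulus q" "z \<noteq> x" "z \<noteq> - x" for z
  proof -
    have z': "- z \<in> qannulus q" "z \<noteq> 0"
      using z by (auto simp: qannulus_def)
    define b where "b = qtheta (- q / z\<^sup>2) (q ^ 4)"
    define C where "C = J 2 q ^ 4 / (J 1 q * J 4 q ^ 2)"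
    have F1: "z * (qtheta (- q * z\<^sup>2) (q ^ 4) * b) * gnum z q + qtheta z q *
        (qtheta (- q * z\<^sup>2) (q ^ 4) * b - q / z\<^sup>2 * qtheta (- q * z\<^sup>2) (q ^ 4) * gnum (- q / z\<^sup>2) (q ^ 4)
          + q * z * b * gnum (- q * z\<^sup>2) (q ^ 4)) = C"
      unfolding b_def C_def by (rule gnum_dissection[OF q z(1)])
    have F2: "- z * (qtheta (- q * z\<^sup>2) (q ^ 4) * b) * gnum (- z) q + qtheta (- z) q *
        (qtheta (- q * z\<^sup>2) (q ^ 4) * b - q / z\<^sup>2 * qtheta (- q * z\<^sup>2) (q ^ 4) * gnum (- q / z\<^sup>2) (q ^ 4)
          - q * z * b * gnum (- q * z\<^sup>2) (q ^ 4)) = C"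
      using gnum_dissection[OF q z'(1)] unfolding b_def C_def by simp
    have r: "qtheta (- (q ^ 3) * z\<^sup>2) (q ^ 4) = b"
    proof -
      have "- (q ^ 3) * z\<^sup>2 = q ^ 4 / (- q / z\<^sup>2)"
        using q z' by (simp add: field_simps power_numeral_reduce)
      then show ?thesis
        unfolding b_def by (simp only: qtheta_reflect[OF q4(2)])
    qed
    \<comment> \<open>By the even-odd splitting, the odd part of theta is z times \<open>b\<close>
      up to \<open>J\<close> factors; this makes the constant side divisible by
      \<open>b\<close>.\<close>
    have E: "J 1 q * (qtheta (- z) q - qtheta z q) = 2 * J 4 q * z * b"
      using qtheta_dissection[OF q z(1)] qtheta_dissection[OF q z'(1)] r
      by (simp add: algebra_simps)
    have "z * b * K z = qtheta (- z) q * C - qtheta z q * C - z * b * (2 * J 2 q ^ 4 / (J 1 q ^ 2 * J 4 q))"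
      unfolding K_def by (subst F1[symmetric], subst F2[symmetric]) (simp add: algebra_simps)
    also have "qtheta (- z) q * C - qtheta z q * C = (2 * J 4 q * z * b) * C / J 1 q"
      unfolding E[symmetric] using nz by (simp add: field_simps)
    also have "\<dots> - z * b * (2 * J 2 q ^ 4 / (J 1 q ^ 2 * J 4 q)) = 0"
      unfolding C_def using nz by (simp add: field_simps power2_eq_square)
    finally have "b * K z = 0"
      using z' by simp
    moreover have "b = (1 - (- q / z\<^sup>2)) * c z"
      unfolding b_def c_def by (rule qtheta_factor[OF q4(1)])
    moreover have "1 - (- q / z\<^sup>2) \<noteq> 0"
    proof
      assume "1 - (- q / z\<^sup>2) = 0"
      then have "q + z\<^sup>2 = 0"
        using z' by (simp add: field_simps)
      then have "z\<^sup>2 = x\<^sup>2"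
        using x by (simp add: add_eq_0_iff)
      then show False
        using z by (simp add: power2_eq_iff)
    qed
    ultimately show ?thesis by simp
  qed
  have "(\<lambda>z. c z * K z) holomorphic_on qannulus q"
    unfolding c_def K_def using q q4
    by (intro holomorphic_intros) (auto dest: qannulus_nonzero)
  then have "isCont (\<lambda>z. c z * K z) x"
    using open_qannulus xA
    by (meson at_within_open continuous_on_eq_continuous_at holomorphic_on_imp_continuous_on)
  then have "(\<lambda>z. c z * K z) \<midarrow>x\<rightarrow> c x * K x"
    by (simp add: isCont_def)
  moreover have "open (qannulus q - {- x})"
    by (intro open_Diff open_qannulus) auto
  then have "eventually (\<lambda>z. z \<in> qannulus q - {- x}) (at x)"
    using xA q x by (intro eventually_at_in_open') auto
  then have "eventually (\<lambda>z. z \<noteq> x \<and> z \<in> qannulus q - {- x}) (at x)"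
    using eventually_at_filter by (auto elim: eventually_mono simp: eventually_at_filter)
  then have "eventually (\<lambda>z. c z * K z = 0) (at x)"
    by (rule eventually_mono) (use zero in auto)
  then have "(\<lambda>z. c z * K z) \<midarrow>x\<rightarrow> 0"
    by (rule tendsto_eventually)
  ultimately have "c x * K x = 0"
    using tendsto_unique trivial_limit_at by blast
  moreover have "- q / x\<^sup>2 = 1"
    using x q by simp
  then have "c x \<noteq> 0"
    unfolding c_def using qpoch_inf_nonzero'[OF q4(1) q4(1)] by simp
  moreover have "- q * x\<^sup>2 = q\<^sup>2"
    using x by (simp add: power2_eq_square)
  ultimately show ?thesis
    unfolding K_def by simp
qed

text \<open>For x = i q reflection in base q^2 sends x to -x, so the two summands of
  \<open>gnum_dissection_even\<close> coincide and determine g. With nu(q^2) = g(i q; q^2) and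
  omega(q^4) = g(q^4; q^8), the first equation is the classical relation between the third-order
  mock theta functions nu and omega.\<close>

lemma g_imaginary:
  assumes q: "norm q < 1" "q \<noteq> 0"
  shows "g (\<i> * q) (q\<^sup>2) = J 8 q ^ 3 / J 4 q ^ 2 - q\<^sup>2 * g (q ^ 4) (q ^ 8)" and "g (- \<i> * q) (q\<^sup>2) = g (\<i> * q) (q\<^sup>2)"
proof -
  have q2: "norm (q\<^sup>2) < 1" "q\<^sup>2 \<noteq> 0" and q4: "norm (q ^ 4) < 1" and q8: "norm (q ^ 8) < 1" "q ^ 8 \<noteq> 0"
    using norm_power_lt_1[OF q(1)] q by auto
  have nz: "J 2 q \<noteq> 0" "J 4 q \<noteq> 0" "J 8 q \<noteq> 0"
    using J_nonzero[OF q(1)] by auto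
  define x where "x = \<i> * q"
  have x: "x\<^sup>2 = - (q\<^sup>2)" "x \<noteq> 0" "q\<^sup>2 / x = - x"
    using q by (simp_all add: x_def power_mult_distrib) (simp add: power2_eq_square)
  have Jp: "J m (q\<^sup>2) = J (2 * m) q" "J m (q ^ 4) = J (4 * m) q" for m
    by (rule J_power)+
  have th: "qtheta x (q\<^sup>2) = J 4 q ^ 2 / (J 2 q * J 8 q)"
    using qpoch_inf_minus_odd_J[OF q2(1)] qpoch_inf_mult_minus[OF q2(1), of x]
    unfolding qtheta_def x(1,3) Jp by simp
  have thr: "qtheta (- x) (q\<^sup>2) = qtheta x (q\<^sup>2)" "gnum (- x) (q\<^sup>2) = gnum x (q\<^sup>2)"
    using qtheta_reflect[OF q2(2), of x] gnum_reflect[OF q2(2), of x] unfolding x(3) by auto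
  have th4: "qtheta (q ^ 4) (q ^ 8) = (J 4 q / J 8 q)\<^sup>2"
    using qtheta_square[OF q4] q by (simp add: J_power power_mult[symmetric])
  have args: "(q\<^sup>2)\<^sup>2 = q ^ 4" "(q\<^sup>2) ^ 4 = q ^ 8"
    by (auto simp: power_numeral_reduce)
  have tnz: "qtheta x (q\<^sup>2) \<noteq> 0" "qtheta (q ^ 4) (q ^ 8) \<noteq> 0"
    unfolding th th4 using nz by auto
  have gs: "gnum x (q\<^sup>2) = g x (q\<^sup>2) * qtheta x (q\<^sup>2)"
    "gnum (q ^ 4) (q ^ 8) = g (q ^ 4) (q ^ 8) * qtheta (q ^ 4) (q ^ 8)"
    using g_eq_gnum[OF q2 x(2) tnz(1)] g_eq_gnum[OF q8 _ tnz(2)] tnz q by auto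
  have "qtheta (q ^ 4) (q ^ 8) * (qtheta x (q\<^sup>2) * gnum x (q\<^sup>2) + qtheta x (q\<^sup>2) * gnum x (q\<^sup>2))
    + 2 * q\<^sup>2 * qtheta x (q\<^sup>2) * qtheta x (q\<^sup>2) * gnum (q ^ 4) (q ^ 8) = 2 * J 4 q ^ 4 / (J 2 q ^ 2 * J 8 q)"
    using gnum_dissection_even[OF q2 x(1)] unfolding args thr Jp by simp
  then have "2 * (qtheta (q ^ 4) (q ^ 8) * qtheta x (q\<^sup>2) ^ 2) * (g x (q\<^sup>2) + q\<^sup>2 * g (q ^ 4) (q ^ 8))
      = 2 * J 4 q ^ 4 / (J 2 q ^ 2 * J 8 q)"
    unfolding gs by (simp add: algebra_simps power2_eq_square)
  moreover have "qtheta (q ^ 4) (q ^ 8) * qtheta x (q\<^sup>2) ^ 2 = J 4 q ^ 6 / (J 2 q ^ 2 * J 8 q ^ 4)"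
    unfolding th th4 using nz by (simp add: field_simps power_numeral_reduce)
  moreover have "2 * J 4 q ^ 4 / (J 2 q ^ 2 * J 8 q) =
      2 * (J 4 q ^ 6 / (J 2 q ^ 2 * J 8 q ^ 4)) * (J 8 q ^ 3 / J 4 q ^ 2)"
    using nz by (simp add: field_simps power_numeral_reduce)
  ultimately have "g x (q\<^sup>2) + q\<^sup>2 * g (q ^ 4) (q ^ 8) = J 8 q ^ 3 / J 4 q ^ 2"
    using nz by (simp only: mult_cancel_left) simp
  then show "g (\<i> * q) (q\<^sup>2) = J 8 q ^ 3 / J 4 q ^ 2 - q\<^sup>2 * g (q ^ 4) (q ^ 8)"
    unfolding x_def by (simp add: algebra_simps)
  show "g (- \<i> * q) (q\<^sup>2) = g (\<i> * q) (q\<^sup>2)"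
    using g_eq_gnum[OF q2 x(2) tnz(1)] g_eq_gnum[OF q2, of "- x"] tnz(1) x(2) thr
    by (simp add: x_def)
qed

section \<open>Generating functions of odd Durfee symbols\<close>

text \<open>Entries are at most 2 k - 1, so the rows of a symbol lie in
  \<open>odd_rows (Suc D)\<close> and induction can start from the empty row alone.\<close>

definition odd_rows :: "nat \<Rightarrow> nat list set" where
  "odd_rows k = {as. sorted_wrt (\<ge>) as \<and> (\<forall>x\<in>set as. odd x \<and> x < 2 * k)}"

lemma odd_rows_0: "odd_rows 0 = {[]}"
  by (auto simp: odd_rows_def)

text \<open>In a non-increasing list the copies of an upper bound all stand in front, so removing
  the leading ones removes all of them.\<close>

lemma dropWhile_max_less:
  fixes c :: nat
  assumes "sorted_wrt (\<ge>) as" "\<forall>x\<in>set as. x \<le> c" "y \<in> set (dropWhile ((=) c) as)"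
  shows "y < c"
  using assms by (induction as) (auto split: if_splits intro: le_neq_trans)

text \<open>A row is determined by the number of its leading entries 2 k + 1 and the rest. Stated as
  an equivalence for general values, it transports sums and summability in both directions, for real
  and complex terms.\<close>

lemma odd_rows_Suc_has_sum_iff:
  fixes f :: "nat list \<Rightarrow> 'a :: {comm_monoid_add, topological_space}"
  shows "((\<lambda>(m, as). f (replicate m (2 * k + 1) @ as)) has_sum S) (UNIV \<times> odd_rows k)
    \<longleftrightarrow> (f has_sum S) (odd_rows (Suc k))"
proof (rule has_sum_reindex_bij_witness[where
      i = "\<lambda>as. (length (takeWhile ((=) (2 * k + 1)) as), dropWhile ((=) (2 * k + 1)) as)" and
      j = "\<lambda>(m, as). replicate m (2 * k + 1) @ as"])
  fix p :: "nat \<times> nat list" assume "p \<in> UNIV \<times> odd_rows k"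
  then obtain m as where p: "p = (m, as)" "as \<in> odd_rows k" by auto
  have ne: "2 * k + 1 \<noteq> x" if "x \<in> set as" for x
    using p that by (auto simp: odd_rows_def)
  have "takeWhile ((=) (2 * k + 1)) as = []" "dropWhile ((=) (2 * k + 1)) as = as"
    using ne by (cases as; simp)+
  then show "(length (takeWhile ((=) (2 * k + 1)) (case p of (m, as) \<Rightarrow> replicate m (2 * k + 1) @ as)),
        dropWhile ((=) (2 * k + 1)) (case p of (m, as) \<Rightarrow> replicate m (2 * k + 1) @ as)) = p"
    by (simp add: p takeWhile_append dropWhile_append)
  have sorted: "sorted_wrt (\<ge>) (replicate m (2 * k + 1))"
    by (induction m) auto
  show "(case p of (m, as) \<Rightarrow> replicate m (2 * k + 1) @ as) \<in> odd_rows (Suc k)"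
    using p sorted by (auto simp: odd_rows_def sorted_wrt_append)
  show "f (case p of (m, as) \<Rightarrow> replicate m (2 * k + 1) @ as) = (case p of (m, as) \<Rightarrow> f (replicate m (2 * k + 1) @ as))"
    by (simp add: p)
next
  fix as assume as: "as \<in> odd_rows (Suc k)"
  have "replicate (length (takeWhile ((=) (2 * k + 1)) as)) (2 * k + 1) = takeWhile ((=) (2 * k + 1)) as"
    by (rule replicate_length_same) (auto dest: set_takeWhileD)
  then show "(case (length (takeWhile ((=) (2 * k + 1)) as), dropWhile ((=) (2 * k + 1)) as) of
      (m, as) \<Rightarrow> replicate m (2 * k + 1) @ as) = as"
    by simp
  have "odd x \<and> x < 2 * k" if "x \<in> set (dropWhile ((=) (2 * k + 1)) as)" for x
  proof -
    have "\<forall>x\<in>set as. x \<le> 2 * k + 1" "odd x"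
      using as set_dropWhileD[OF that] by (auto simp: odd_rows_def)
    then have "x < 2 * k + 1"
      using dropWhile_max_less[OF _ _ that] as by (simp add: odd_rows_def)
    with \<open>odd x\<close> show ?thesis by presburger
  qed
  then show "(length (takeWhile ((=) (2 * k + 1)) as), dropWhile ((=) (2 * k + 1)) as) \<in> UNIV \<times> odd_rows k"
    using as by (auto simp: odd_rows_def sorted_wrt_dropWhile)
qed simp

lemma sum_list_replicate_append:
  fixes c :: nat
  shows "sum_list (replicate m c @ as) = c * m + sum_list as"
  by (simp add: sum_list_replicate)

text \<open>With nonnegative terms, summability of the iterated sums already gives that of the
  double sum. The complex version takes its absolute convergence from here.\<close>

lemma odd_rows_has_sum_real:
  fixes r :: real
  assumes r: "0 \<le> r" "r < 1"
  shows "((\<lambda>as. r ^ sum_list as) has_sum (\<Prod>j<k. inverse (1 - r ^ (2 * j + 1)))) (odd_rows k)"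
proof (induction k)
  case 0
  show ?case
    unfolding odd_rows_0 by (rule has_sum_finiteI) auto
next
  case (Suc k)
  define c where "c = r ^ (2 * k + 1)"
  define P where "P = (\<Prod>j<k. inverse (1 - r ^ (2 * j + 1)))"
  have c: "0 \<le> c" "c < 1"
    using r power_decreasing[of 1 "2 * k + 1" r] by (auto simp: c_def)
  have pow: "r ^ sum_list (replicate m (2 * k + 1) @ as) = c ^ m * r ^ sum_list as" for m as
    unfolding sum_list_replicate_append power_add[of r "(2 * k + 1) * m"] power_mult c_def ..
  have inner: "((\<lambda>as. c ^ m * r ^ sum_list as) has_sum c ^ m * P) (odd_rows k)" for m
    unfolding P_def by (intro has_sum_cmult_right Suc)
  have outer: "((\<lambda>m. c ^ m * P) has_sum (1 / (1 - c) * P)) UNIV"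
    using c by (intro has_sum_cmult_left norm_summable_imp_has_sum geometric_sums) (auto intro!: summable_geometric)
  have "((\<lambda>(m, as). c ^ m * r ^ sum_list as) has_sum (1 / (1 - c) * P)) (UNIV \<times> odd_rows k)"
    using inner outer r c
    by (intro has_sum_SigmaI summable_on_SigmaI) (auto dest: has_sum_imp_summable)
  then have "((\<lambda>(m, as). r ^ sum_list (replicate m (2 * k + 1) @ as)) has_sum (1 / (1 - c) * P)) (UNIV \<times> odd_rows k)"
    unfolding pow .
  then have "((\<lambda>as. r ^ sum_list as) has_sum (1 / (1 - c) * P)) (odd_rows (Suc k))"
    unfolding odd_rows_Suc_has_sum_iff[of "\<lambda>as. r ^ sum_list as"] .
  then show ?case
    by (simp add: P_def c_def divide_inverse mult.commute)
qed

text \<open>As |z| = 1, the norms of the terms are those of the real case. Each new admissible part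
  contributes a geometric series with ratio z q^(2k+1).\<close>

lemma odd_rows_has_sum:
  fixes z q :: complex
  assumes z: "norm z = 1" and q: "norm q < 1"
  shows "((\<lambda>as. z ^ length as * q ^ sum_list as) has_sum inverse (qpoch (z * q) (q\<^sup>2) k)) (odd_rows k)"
proof (induction k)
  case 0
  show ?case
    unfolding odd_rows_0 by (rule has_sum_finiteI) (auto simp: qpoch_def)
next
  case (Suc k)
  define c where "c = z * q ^ (2 * k + 1)"
  define P where "P = inverse (qpoch (z * q) (q\<^sup>2) k)"
  have c: "norm c < 1"
    using z norm_power_lt_1[OF q, of "2 * k + 1"] by (simp add: c_def norm_mult)
  have pow: "z ^ length (replicate m (2 * k + 1) @ as) * q ^ sum_list (replicate m (2 * k + 1) @ as)
      = c ^ m * (z ^ length as * q ^ sum_list as)" for m as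
    unfolding sum_list_replicate_append power_add[of q "(2 * k + 1) * m"] power_mult[of q "2 * k + 1" m]
      length_append length_replicate power_add[of z] c_def power_mult_distrib
    by (simp only: mult_ac)
  have inner: "((\<lambda>as. c ^ m * (z ^ length as * q ^ sum_list as)) has_sum c ^ m * P) (odd_rows k)" for m
    unfolding P_def by (intro has_sum_cmult_right Suc)
  have outer: "((\<lambda>m. c ^ m * P) has_sum (1 / (1 - c) * P)) UNIV"
    using c by (intro has_sum_cmult_left norm_summable_imp_has_sum geometric_sums)
      (auto intro!: summable_geometric simp: norm_power)
  have "(\<lambda>as. z ^ length as * q ^ sum_list as) summable_on odd_rows (Suc k)"
  proof (rule abs_summable_summable)
    have "(\<lambda>as. norm q ^ sum_list as) summable_on odd_rows (Suc k)"
      using odd_rows_has_sum_real[of "norm q" "Suc k"] q by (auto dest: has_sum_imp_summable)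
    then show "(\<lambda>as. norm (z ^ length as * q ^ sum_list as)) summable_on odd_rows (Suc k)"
      using z by (simp add: norm_mult norm_power)
  qed
  then have "(\<lambda>(m, as). c ^ m * (z ^ length as * q ^ sum_list as)) summable_on (UNIV \<times> odd_rows k)"
    unfolding summable_on_def
      odd_rows_Suc_has_sum_iff[of "\<lambda>as. z ^ length as * q ^ sum_list as", symmetric] pow .
  then have "((\<lambda>(m, as). c ^ m * (z ^ length as * q ^ sum_list as)) has_sum (1 / (1 - c) * P)) (UNIV \<times> odd_rows k)"
    using inner outer by (intro has_sum_SigmaI) auto
  then have "((\<lambda>(m, as). z ^ length (replicate m (2 * k + 1) @ as) * q ^ sum_list (replicate m (2 * k + 1) @ as))
      has_sum (1 / (1 - c) * P)) (UNIV \<times> odd_rows k)"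
    unfolding pow .
  moreover have "c = z * q * (q\<^sup>2) ^ k"
    by (simp add: c_def power_mult)
  then have "1 / (1 - c) * P = inverse (qpoch (z * q) (q\<^sup>2) (Suc k))"
    by (simp add: P_def qpoch_def divide_inverse)
  ultimately show ?case
    unfolding odd_rows_Suc_has_sum_iff[of "\<lambda>as. z ^ length as * q ^ sum_list as"] by simp
qed

lemma odd_rows_pairs_has_sum:
  fixes z q :: complex
  assumes z: "norm z = 1" and q: "norm q < 1"
  shows "((\<lambda>(as, bs). (z ^ length as * q ^ sum_list as) * (inverse z ^ length bs * q ^ sum_list bs))
    has_sum inverse (qpoch (z * q) (q\<^sup>2) k) * inverse (qpoch (inverse z * q) (q\<^sup>2) k)) (odd_rows k \<times> odd_rows k)"
proof -
  define P where "P = (\<Prod>j<k. inverse (1 - norm q ^ (2 * j + 1)))"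
  have real: "((\<lambda>as. norm q ^ sum_list as) has_sum P) (odd_rows k)"
    unfolding P_def using q by (intro odd_rows_has_sum_real) auto
  have "(\<lambda>(as, bs). norm q ^ sum_list as * norm q ^ sum_list bs) summable_on (odd_rows k \<times> odd_rows k)"
    using has_sum_cmult_right[OF real] has_sum_cmult_left[OF real, of P]
    by (intro summable_on_SigmaI[where g = "\<lambda>as. norm q ^ sum_list as * P"]) (auto dest: has_sum_imp_summable)
  then have "(\<lambda>p. norm (case p of (as, bs) \<Rightarrow>
      (z ^ length as * q ^ sum_list as) * (inverse z ^ length bs * q ^ sum_list bs))) summable_on (odd_rows k \<times> odd_rows k)"
    using z by (simp add: case_prod_unfold norm_mult norm_power norm_inverse)
  then have summ: "(\<lambda>(as, bs). (z ^ length as * q ^ sum_list as) * (inverse z ^ length bs * q ^ sum_list bs))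
      summable_on (odd_rows k \<times> odd_rows k)"
    by (rule abs_summable_summable)
  have z': "norm (inverse z) = 1"
    using z by (simp add: norm_inverse)
  show ?thesis
    using has_sum_cmult_right[OF odd_rows_has_sum[OF z' q]] has_sum_cmult_left[OF odd_rows_has_sum[OF z q]] summ
    by (intro has_sum_SigmaI[where g = "\<lambda>as. (z ^ length as * q ^ sum_list as) * inverse (qpoch (inverse z * q) (q\<^sup>2) k)"]) auto
qed

text \<open>Absolute convergence over all symbols, which permits grouping them both by D and by
  size. The row factors stay bounded in D, so the quadratic exponent decides.\<close>

lemma odd_durfee_summable:
  fixes r :: real
  assumes r: "0 \<le> r" "r < 1"
  shows "(\<lambda>(D, as, bs). r ^ (2 * D\<^sup>2 + 2 * D + 1) * (r ^ sum_list as * r ^ sum_list bs))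
    summable_on (SIGMA D:UNIV. odd_rows (Suc D) \<times> odd_rows (Suc D))"
proof -
  define P where "P k = (\<Prod>j<k. inverse (1 - r ^ (2 * j + 1)))" for k
  have P: "((\<lambda>as. r ^ sum_list as) has_sum P k) (odd_rows k)" for k
    unfolding P_def using r by (intro odd_rows_has_sum_real) auto
  have P_nonneg: "P k \<ge> 0" for k
    unfolding P_def using power_le_one[OF r(1), of "2 * _ + 1"] r(2) by (intro prod_nonneg) auto
  have row: "((\<lambda>as. r ^ sum_list as * P k) has_sum P k * P k) (odd_rows k)" for k
    by (intro has_sum_cmult_left P)
  have pairs: "((\<lambda>(as, bs). r ^ sum_list as * r ^ sum_list bs) has_sum P k * P k) (odd_rows k \<times> odd_rows k)" for k
    using has_sum_cmult_right[OF P] row has_sum_imp_summable[OF row] r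
    by (intro has_sum_SigmaI[where g = "\<lambda>as. r ^ sum_list as * P k"] summable_on_SigmaI[where g = "\<lambda>as. r ^ sum_list as * P k"])
      auto
  define q where "q = complex_of_real r"
  have q: "norm q < 1" "norm (q\<^sup>2) < 1"
    using r norm_power_lt_1[of q 2] by (auto simp: q_def)
  \<comment> \<open>From 1/(q; q^2)_k = (q^(2k+1); q^2)_inf / (q; q^2)_inf, whose numerator is
    bounded uniformly in k.\<close>
  define B where "B = exp (norm q / (1 - norm (q\<^sup>2))) / norm (qpoch_inf q (q\<^sup>2))"
  have P_le: "P k \<le> B" for k
  proof -
    have nz: "qpoch_inf q (q\<^sup>2) \<noteq> 0"
      using q by (intro qpoch_inf_nonzero')
    have "P k = norm (inverse (qpoch q (q\<^sup>2) k))"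
    proof -
      have "inverse (qpoch q (q\<^sup>2) k) = complex_of_real (P k)"
        by (simp add: qpoch_def P_def q_def prod_inversef[symmetric] o_def power_mult[symmetric])
      then show ?thesis
        using P_nonneg[of k] by simp
    qed
    also have "inverse (qpoch q (q\<^sup>2) k) = qpoch_inf (q * (q\<^sup>2) ^ k) (q\<^sup>2) / qpoch_inf q (q\<^sup>2)"
      using qpoch_inf_split[OF q(2), of q k] nz by (auto simp: field_simps)
    also have "norm \<dots> \<le> B"
    proof -
      have "norm (q * (q\<^sup>2) ^ k) \<le> norm q * 1"
        unfolding norm_mult norm_power by (intro mult_left_mono power_le_one) (use q in \<open>auto simp: norm_power power_le_one\<close>)
      then have "norm (qpoch_inf (q * (q\<^sup>2) ^ k) (q\<^sup>2)) \<le> exp (norm q / (1 - norm (q\<^sup>2)))"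
        by (intro order_trans[OF norm_qpoch_inf_le[OF q(2)]]) (use q in \<open>auto intro!: divide_right_mono\<close>)
      then show ?thesis
        unfolding B_def norm_divide by (intro divide_right_mono) auto
    qed
    finally show ?thesis .
  qed
  have "summable (\<lambda>D. r ^ (2 * D\<^sup>2 + 2 * D + 1) * (P (Suc D) * P (Suc D)))"
  proof (rule summable_comparison_test')
    show "summable (\<lambda>D. r ^ D * (B * B))"
      using r by (intro summable_mult2 summable_geometric) simp
    fix D :: nat
    have "norm (r ^ (2 * D\<^sup>2 + 2 * D + 1) * (P (Suc D) * P (Suc D))) = r ^ (2 * D\<^sup>2 + 2 * D + 1) * (P (Suc D) * P (Suc D))"
      using r P_nonneg by (simp add: abs_mult)
    also have "\<dots> \<le> r ^ D * (B * B)"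
      using P_le P_nonneg r order_trans[OF P_nonneg P_le] by (intro mult_mono power_decreasing) auto
    finally show "norm (r ^ (2 * D\<^sup>2 + 2 * D + 1) * (P (Suc D) * P (Suc D))) \<le> r ^ D * (B * B)" .
  qed
  then have "(\<lambda>D. r ^ (2 * D\<^sup>2 + 2 * D + 1) * (P (Suc D) * P (Suc D))) summable_on UNIV"
    using r P_nonneg by (intro summable_nonneg_imp_summable_on) auto
  then show ?thesis
    using has_sum_cmult_right[OF pairs] r
    by (intro summable_on_SigmaI[where g = "\<lambda>D. r ^ (2 * D\<^sup>2 + 2 * D + 1) * (P (Suc D) * P (Suc D))"])
      (auto simp: case_prod_unfold)
qed

text \<open>Grouped by D, the symbols sum to q times the series with terms q^(2 D (D+1)) / ((z q;
  q^2)_(D+1) (q/z; q^2)_(D+1)), which is \<open>gnum\<close> over \<open>qtheta\<close> in base q^2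
  at z q. Grouped by size, the same sum is the left-hand side.\<close>

lemma odd_durfee_gen_fun:
  fixes z q :: complex
  assumes z: "norm z = 1" and q: "norm q < 1" "q \<noteq> 0"
  shows "(\<lambda>n. (\<Sum>(D, as, bs)\<in>odd_durfee_symbols n. z ^ length as * inverse z ^ length bs) * q ^ n)
    sums (q * g (z * q) (q\<^sup>2))"
proof -
  define U where "U = (SIGMA D:(UNIV :: nat set). odd_rows (Suc D) \<times> odd_rows (Suc D))"
  define f where "f = (\<lambda>(D :: nat, as, bs). q ^ (2 * D\<^sup>2 + 2 * D + 1) *
    ((z ^ length as * q ^ sum_list as) * (inverse z ^ length bs * q ^ sum_list bs)))"
  have "(\<lambda>s. norm (f s)) summable_on U"
  proof -
    have "norm (f s) = (case s of (D, as, bs) \<Rightarrow> norm q ^ (2 * D\<^sup>2 + 2 * D + 1) * (norm q ^ sum_list as * norm q ^ sum_list bs))" for s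
      using z by (simp add: f_def case_prod_unfold norm_mult norm_power norm_inverse)
    then show ?thesis
      unfolding U_def using odd_durfee_summable[of "norm q"] q by simp
  qed
  then have "f summable_on U"
    by (rule abs_summable_summable)
  then obtain S where S: "(f has_sum S) U"
    unfolding summable_on_def by blast
  have q2: "norm (q\<^sup>2) < 1" "q\<^sup>2 \<noteq> 0"
    using norm_power_lt_1[OF q(1)] q by auto
  define x where "x = z * q"
  have x: "x \<noteq> 0" "norm x < 1" "q\<^sup>2 / x = inverse z * q" "norm (inverse z * q) < 1"
    using z q by (auto simp: x_def norm_mult norm_inverse norm_divide field_simps power2_eq_square)
  have th: "qtheta x (q\<^sup>2) \<noteq> 0"
    unfolding qtheta_def x(3) using qpoch_inf_nonzero'[OF q2(1)] x by simp
  have "((\<lambda>D. q ^ (2 * D\<^sup>2 + 2 * D + 1) * (inverse (qpoch (z * q) (q\<^sup>2) (Suc D)) *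
      inverse (qpoch (inverse z * q) (q\<^sup>2) (Suc D)))) has_sum S) UNIV"
  proof (rule has_sum_SigmaD[OF S[unfolded U_def]])
    fix D :: nat
    show "((\<lambda>p. f (D, p)) has_sum q ^ (2 * D\<^sup>2 + 2 * D + 1) * (inverse (qpoch (z * q) (q\<^sup>2) (Suc D)) *
      inverse (qpoch (inverse z * q) (q\<^sup>2) (Suc D)))) (odd_rows (Suc D) \<times> odd_rows (Suc D))"
      using has_sum_cmult_right[OF odd_rows_pairs_has_sum[OF z q(1)]] by (simp add: f_def case_prod_unfold)
  qed
  then have "(\<lambda>D. q ^ (2 * D\<^sup>2 + 2 * D + 1) * (inverse (qpoch (z * q) (q\<^sup>2) (Suc D)) *
      inverse (qpoch (inverse z * q) (q\<^sup>2) (Suc D)))) sums S"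
    by (rule has_sum_imp_sums)
  moreover have "(\<lambda>D. q * ((q\<^sup>2) ^ (D * (D + 1)) * (qpoch_inf (x * (q\<^sup>2) ^ (D + 1)) (q\<^sup>2) *
      qpoch_inf ((q\<^sup>2) ^ (D + 2) / x) (q\<^sup>2)) / qtheta x (q\<^sup>2))) sums (q * (gnum x (q\<^sup>2) / qtheta x (q\<^sup>2)))"
    by (intro sums_mult sums_divide gnum_sums q2)
  moreover have "q * ((q\<^sup>2) ^ (D * (D + 1)) * (qpoch_inf (x * (q\<^sup>2) ^ (D + 1)) (q\<^sup>2) *
      qpoch_inf ((q\<^sup>2) ^ (D + 2) / x) (q\<^sup>2)) / qtheta x (q\<^sup>2))
      = q ^ (2 * D\<^sup>2 + 2 * D + 1) * (inverse (qpoch (z * q) (q\<^sup>2) (Suc D)) *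
      inverse (qpoch (inverse z * q) (q\<^sup>2) (Suc D)))" for D
  proof -
    have "q\<^sup>2 / x * (q\<^sup>2) ^ (Suc D) = (q\<^sup>2) ^ (D + 2) / x"
      by simp
    then have t: "qtheta x (q\<^sup>2) = (qpoch x (q\<^sup>2) (Suc D) * qpoch (q\<^sup>2 / x) (q\<^sup>2) (Suc D)) *
        (qpoch_inf (x * (q\<^sup>2) ^ (D + 1)) (q\<^sup>2) * qpoch_inf ((q\<^sup>2) ^ (D + 2) / x) (q\<^sup>2))"
      using qpoch_inf_split[OF q2(1), of x "Suc D"] qpoch_inf_split[OF q2(1), of "q\<^sup>2 / x" "Suc D"]
      by (simp add: qtheta_def mult_ac)
    have "2 * D\<^sup>2 + 2 * D + 1 = Suc (2 * (D * (D + 1)))"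
      by (simp add: power2_eq_square)
    then have e: "q ^ (2 * D\<^sup>2 + 2 * D + 1) = q * (q\<^sup>2) ^ (D * (D + 1))"
      by (simp only: power_Suc power_mult)
    define u where "u = qpoch x (q\<^sup>2) (Suc D) * qpoch (q\<^sup>2 / x) (q\<^sup>2) (Suc D)"
    define v where "v = qpoch_inf (x * (q\<^sup>2) ^ (D + 1)) (q\<^sup>2) * qpoch_inf ((q\<^sup>2) ^ (D + 2) / x) (q\<^sup>2)"
    have "v / qtheta x (q\<^sup>2) = inverse u"
      using th unfolding t u_def[symmetric] v_def[symmetric] by (simp add: field_simps)
    then have "q * ((q\<^sup>2) ^ (D * (D + 1)) * v / qtheta x (q\<^sup>2)) = q * (q\<^sup>2) ^ (D * (D + 1)) * inverse u"
      by (metis mult.assoc times_divide_eq_right)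
    then show ?thesis
      unfolding v_def[symmetric] e unfolding u_def x(3) by (simp only: x_def inverse_mult_distrib)
  qed
  ultimately have Sval: "S = q * g (z * q) (q\<^sup>2)"
    using sums_unique2 g_eq_gnum[OF q2 x(1) th] by (simp add: x_def)
  \<comment> \<open>A symbol determines its size, so attaching the size to it loses and adds
    nothing.\<close>
  have bij: "((\<lambda>(n, s). f s) has_sum S) (SIGMA n:UNIV. odd_durfee_symbols n) \<longleftrightarrow> (f has_sum S) U"
  proof (rule has_sum_reindex_bij_witness[where j = snd and
        i = "\<lambda>(D, as, bs). (sum_list as + sum_list bs + 2 * D\<^sup>2 + 2 * D + 1, (D, as, bs))"])
    fix p assume "p \<in> (SIGMA n:UNIV. odd_durfee_symbols n)"
    then obtain n D as bs where p: "p = (n, D, as, bs)" "(D, as, bs) \<in> odd_durfee_symbols n"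
      by (cases p) auto
    show "(case snd p of (D, as, bs) \<Rightarrow> (sum_list as + sum_list bs + 2 * D\<^sup>2 + 2 * D + 1, (D, as, bs))) = p"
      using p by (simp add: odd_durfee_symbols_def)
    show "snd p \<in> U"
      using p by (auto simp: odd_durfee_symbols_def U_def odd_rows_def le_imp_less_Suc)
    show "f (snd p) = (case p of (n, s) \<Rightarrow> f s)"
      by (simp add: case_prod_unfold)
  next
    fix s assume "s \<in> U"
    then obtain D as bs where s: "s = (D, as, bs)" "as \<in> odd_rows (Suc D)" "bs \<in> odd_rows (Suc D)"
      by (auto simp: U_def)
    show "snd (case s of (D, as, bs) \<Rightarrow> (sum_list as + sum_list bs + 2 * D\<^sup>2 + 2 * D + 1, (D, as, bs))) = s"
      by (simp add: s)
    show "(case s of (D, as, bs) \<Rightarrow> (sum_list as + sum_list bs + 2 * D\<^sup>2 + 2 * D + 1, (D, as, bs)))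
        \<in> (SIGMA n:UNIV. odd_durfee_symbols n)"
      using s by (auto simp: odd_durfee_symbols_def odd_rows_def less_Suc_eq_le)
  qed simp
  have "((\<lambda>n. (\<Sum>(D, as, bs)\<in>odd_durfee_symbols n. z ^ length as * inverse z ^ length bs) * q ^ n) has_sum S) UNIV"
  proof (rule has_sum_SigmaD[OF bij[THEN iffD2, OF S]])
    fix n :: nat
    show "((\<lambda>s. case (n, s) of (n, s) \<Rightarrow> f s) has_sum
        (\<Sum>(D, as, bs)\<in>odd_durfee_symbols n. z ^ length as * inverse z ^ length bs) * q ^ n) (odd_durfee_symbols n)"
    proof (rule has_sum_finiteI[OF finite_odd_durfee_symbols])
      show "(\<Sum>(D, as, bs)\<in>odd_durfee_symbols n. z ^ length as * inverse z ^ length bs) * q ^ n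
          = (\<Sum>s\<in>odd_durfee_symbols n. case (n, s) of (n, s) \<Rightarrow> f s)"
        unfolding sum_distrib_right
        by (intro sum.cong) (auto simp: odd_durfee_symbols_def f_def power_add mult_ac)
    qed
  qed
  then show ?thesis
    unfolding Sval by (rule has_sum_imp_sums)
qed

text \<open>Orthogonality of the characters modulo 4: for residue a the weight of
  \<open>ch z\<close> is z^(-a)/4.\<close>

lemma roots_of_unity_filter:
  fixes s t :: nat
  defines "ch \<equiv> \<lambda>z :: complex. z ^ s * inverse z ^ t"
  shows "of_bool [int s - int t = 0] (mod 4) = (ch 1 + ch (-1) + ch \<i> + ch (- \<i>)) / 4"
    and "of_bool [int s - int t = 2] (mod 4) = (ch 1 + ch (-1) - ch \<i> - ch (- \<i>)) / 4"
    and "of_bool [int s - int t = 1] (mod 4) = (ch 1 - ch (-1) - \<i> * ch \<i> + \<i> * ch (- \<i>)) / 4"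
proof -
  \<comment> \<open>A natural number congruent to s - t modulo 4, matching 1/z = z^3 at fourth roots
    of unity.\<close>
  define m where "m = s + 3 * t"
  have inv: "inverse z = z ^ 3" if "z ^ 4 = 1" for z :: complex
    using that by (intro inverse_unique) (simp add: power_numeral_reduce)
  have ch: "ch z = z ^ (m mod 4)" if "z ^ 4 = 1" for z
  proof -
    have "ch z = z ^ m"
      unfolding ch_def inv[OF that] m_def by (simp add: power_add power_mult)
    also have "\<dots> = z ^ (4 * (m div 4) + m mod 4)"
      by simp
    also have "\<dots> = z ^ (m mod 4)"
      unfolding power_add power_mult that by simp
    finally show ?thesis .
  qed
  have i4: "\<i> ^ 4 = 1" "(- \<i>) ^ 4 = 1" "(1 :: complex) ^ 4 = 1" "(- 1 :: complex) ^ 4 = 1"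
    by (simp_all add: power_numeral_reduce)
  have "int m mod 4 = (int s - int t) mod 4"
    unfolding m_def by presburger
  then have m: "(int s - int t) mod 4 = int (m mod 4)"
    by (simp add: zmod_int)
  have cong: "[int s - int t = 0] (mod 4) \<longleftrightarrow> m mod 4 = 0" "[int s - int t = 1] (mod 4) \<longleftrightarrow> m mod 4 = 1"
    "[int s - int t = 2] (mod 4) \<longleftrightarrow> m mod 4 = 2"
    unfolding cong_def m by auto
  have "m mod 4 = 0 \<or> m mod 4 = 1 \<or> m mod 4 = 2 \<or> m mod 4 = 3"
    by presburger
  then show "of_bool [int s - int t = 0] (mod 4) = (ch 1 + ch (-1) + ch \<i> + ch (- \<i>)) / 4"
    and "of_bool [int s - int t = 2] (mod 4) = (ch 1 + ch (-1) - ch \<i> - ch (- \<i>)) / 4"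
    and "of_bool [int s - int t = 1] (mod 4) = (ch 1 - ch (-1) - \<i> * ch \<i> + \<i> * ch (- \<i>)) / 4"
    unfolding cong ch[OF i4(1)] ch[OF i4(2)] ch[OF i4(3)] ch[OF i4(4)]
    by (auto simp: power_numeral_reduce)
qed

section \<open>Counts by residue class as combinations of values of \<open>g\<close>\<close>

lemma N0_eq_sum:
  "of_nat (N0 a 4 n) = (\<Sum>(D, as, bs)\<in>odd_durfee_symbols n. of_bool [int (length as) - int (length bs) = a] (mod 4))"
proof -
  have "(\<Sum>S\<in>odd_durfee_symbols n. of_bool [odd_rank S = a] (mod 4)) =
      (of_nat (card (odd_durfee_symbols n \<inter> {S. [odd_rank S = a] (mod 4)})) :: 'a)"
    by (simp add: finite_odd_durfee_symbols)
  moreover have "odd_durfee_symbols n \<inter> {S. [odd_rank S = a] (mod 4)} = {S \<in> odd_durfee_symbols n. [odd_rank S = a] (mod 4)}"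
    by blast
  ultimately show ?thesis
    unfolding N0_def by (simp add: case_prod_unfold) (metis (no_types, lifting) odd_rank.simps prod.collapse sum.cong)
qed

lemma N0_gen_funs:
  assumes q: "norm q < 1" "q \<noteq> 0"
  defines "w \<equiv> \<lambda>z. q * g (z * q) (q\<^sup>2)"
  shows "(\<lambda>n. of_nat (N0 0 4 n) * q ^ n) sums ((w 1 + w (-1) + w \<i> + w (- \<i>)) / 4)"
    and "(\<lambda>n. of_nat (N0 2 4 n) * q ^ n) sums ((w 1 + w (-1) - w \<i> - w (- \<i>)) / 4)"
    and "(\<lambda>n. of_nat (N0 1 4 n) * q ^ n) sums ((w 1 - w (-1) - \<i> * w \<i> + \<i> * w (- \<i>)) / 4)"
proof -
  define c where "c z n = (\<Sum>(D, as, bs)\<in>odd_durfee_symbols n. z ^ length as * inverse z ^ length bs)" for z :: complex and n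
  have c: "(\<lambda>n. c z n * q ^ n) sums w z" if "norm z = 1" for z
    unfolding c_def w_def using odd_durfee_gen_fun[OF that q] .
  have N: "of_nat (N0 0 4 n) = (c 1 n + c (-1) n + c \<i> n + c (- \<i>) n) / 4"
    "of_nat (N0 2 4 n) = (c 1 n + c (-1) n - c \<i> n - c (- \<i>) n) / 4"
    "of_nat (N0 1 4 n) = (c 1 n - c (-1) n - \<i> * c \<i> n + \<i> * c (- \<i>) n) / 4" for n
    unfolding N0_eq_sum c_def roots_of_unity_filter
    by (simp_all only: case_prod_unfold sum.distrib sum_subtractf sum_divide_distrib[symmetric] sum_distrib_left)
  have "(\<lambda>n. (c 1 n * q ^ n + c (-1) n * q ^ n + c \<i> n * q ^ n + c (- \<i>) n * q ^ n) / 4) sums ((w 1 + w (-1) + w \<i> + w (- \<i>)) / 4)"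
    "(\<lambda>n. (c 1 n * q ^ n + c (-1) n * q ^ n - c \<i> n * q ^ n - c (- \<i>) n * q ^ n) / 4) sums ((w 1 + w (-1) - w \<i> - w (- \<i>)) / 4)"
    "(\<lambda>n. (c 1 n * q ^ n - c (-1) n * q ^ n - \<i> * (c \<i> n * q ^ n) + \<i> * (c (- \<i>) n * q ^ n)) / 4)
      sums ((w 1 - w (-1) - \<i> * w \<i> + \<i> * w (- \<i>)) / 4)"
    by (intro sums_divide sums_add sums_diff sums_mult c; simp)+
  then show "(\<lambda>n. of_nat (N0 0 4 n) * q ^ n) sums ((w 1 + w (-1) + w \<i> + w (- \<i>)) / 4)"
    "(\<lambda>n. of_nat (N0 2 4 n) * q ^ n) sums ((w 1 + w (-1) - w \<i> - w (- \<i>)) / 4)"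
    "(\<lambda>n. of_nat (N0 1 4 n) * q ^ n) sums ((w 1 - w (-1) - \<i> * w \<i> + \<i> * w (- \<i>)) / 4)"
    unfolding N by (simp_all add: algebra_simps)
qed

section \<open>Arithmetic progressions\<close>

text \<open>Ramanujan's phi(-q) and phi(q) stand on the left; the equations are phi(q) = phi(q^4) +
  2 q psi(q^8) and its image under q \<mapsto> -q. They are \<open>qtheta_dissection\<close> in base
  q^2 at x = q and x = -q.\<close>

lemma J_phi:
  assumes q: "norm q < 1" "q \<noteq> 0"
  shows "J 1 q ^ 2 / J 2 q = J 8 q ^ 5 / (J 4 q ^ 2 * J 16 q ^ 2) - 2 * q * (J 16 q ^ 2 / J 8 q)"
    and "J 2 q ^ 5 / (J 1 q ^ 2 * J 4 q ^ 2) = J 8 q ^ 5 / (J 4 q ^ 2 * J 16 q ^ 2) + 2 * q * (J 16 q ^ 2 / J 8 q)"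
proof -
  have q2: "norm (q\<^sup>2) < 1" "q\<^sup>2 \<noteq> 0" and q4: "norm (q ^ 4) < 1" "q ^ 4 \<noteq> 0" and q8: "norm (q ^ 8) < 1" "q ^ 8 \<noteq> 0"
    using norm_power_lt_1[OF q(1)] q by auto
  have x: "q \<in> qannulus (q\<^sup>2)" "- q \<in> qannulus (q\<^sup>2)"
    using q norm_power_lt_1[OF q(1), of 3] mult_strict_left_mono[OF q(1), of "norm q"]
    by (auto simp: qannulus_def norm_power norm_mult power2_eq_square power_numeral_reduce)
  have nz: "J 1 q \<noteq> 0" "J 2 q \<noteq> 0" "J 4 q \<noteq> 0" "J 8 q \<noteq> 0" "J 16 q \<noteq> 0"
    using J_nonzero[OF q(1)] by auto
  have th4: "qtheta (- (q ^ 4)) (q ^ 8) = (J 8 q ^ 2 / (J 4 q * J 16 q))\<^sup>2"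
    using qtheta_minus_square[OF q4] by (simp add: J_power power_mult[symmetric])
  have th8: "qtheta (- (q ^ 8)) (q ^ 8) = 2 * (J 16 q / J 8 q)\<^sup>2"
    using qpoch_inf_minus_J[OF q8(1)] qpoch_inf_rec[OF q8(1), of "-1"] q
    by (simp add: qtheta_def J_power power2_eq_square)
  have args: "- (q\<^sup>2) * (- q)\<^sup>2 = - (q ^ 4)" "- (q\<^sup>2) * q\<^sup>2 = - (q ^ 4)"
    "- ((q\<^sup>2) ^ 3) * (- q)\<^sup>2 = - (q ^ 8)" "- ((q\<^sup>2) ^ 3) * q\<^sup>2 = - (q ^ 8)" "(q\<^sup>2) ^ 4 = q ^ 8"
    by (simp_all add: power_add[symmetric] power_mult[symmetric])
  have Jp: "J m (q\<^sup>2) = J (2 * m) q" for m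
    by (rule J_power)
  have "J 2 q * (J 1 q / J 2 q)\<^sup>2 = J 8 q * ((J 8 q ^ 2 / (J 4 q * J 16 q))\<^sup>2 - q * (2 * (J 16 q / J 8 q)\<^sup>2))"
    using qtheta_dissection[OF q2 x(1)] unfolding args Jp th4 th8 qtheta_square[OF q] by simp
  then show "J 1 q ^ 2 / J 2 q = J 8 q ^ 5 / (J 4 q ^ 2 * J 16 q ^ 2) - 2 * q * (J 16 q ^ 2 / J 8 q)"
    using nz by (simp add: right_diff_distrib power_numeral_reduce mult_ac)
  have "J 2 q * (J 2 q ^ 2 / (J 1 q * J 4 q))\<^sup>2 = J 8 q * ((J 8 q ^ 2 / (J 4 q * J 16 q))\<^sup>2 + q * (2 * (J 16 q / J 8 q)\<^sup>2))"
    using qtheta_dissection[OF q2 x(2)] unfolding args Jp th4 th8 qtheta_minus_square[OF q] by simp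
  then show "J 2 q ^ 5 / (J 1 q ^ 2 * J 4 q ^ 2) = J 8 q ^ 5 / (J 4 q ^ 2 * J 16 q ^ 2) + 2 * q * (J 16 q ^ 2 / J 8 q)"
    using nz by (simp add: distrib_left power_numeral_reduce mult_ac)
qed

text \<open>1/J_1^2 is phi(q) times a quotient in J_2 and J_4, which are already functions of
  q^2.\<close>

lemma J_square_dissection:
  assumes q: "norm q < 1" "q \<noteq> 0"
  shows "1 / J 1 q ^ 2 = J 8 q ^ 5 / (J 2 q ^ 5 * J 16 q ^ 2) + 2 * q * (J 4 q ^ 2 * J 16 q ^ 2 / (J 2 q ^ 5 * J 8 q))"
proof -
  have nz: "J 1 q \<noteq> 0" "J 2 q \<noteq> 0" "J 4 q \<noteq> 0" "J 8 q \<noteq> 0" "J 16 q \<noteq> 0"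
    using J_nonzero[OF q(1)] by auto
  have "1 / J 1 q ^ 2 = J 4 q ^ 2 / J 2 q ^ 5 * (J 2 q ^ 5 / (J 1 q ^ 2 * J 4 q ^ 2))"
    using nz by simp
  then show ?thesis
    unfolding J_phi(2)[OF q] using nz by (simp add: distrib_left mult_ac)
qed

text \<open>From phi(p) phi(-p) = phi(-p^2)^2 with p^2 = q: multiplying the two equations of
  \<open>J_phi\<close> at p leaves a difference of squares in which p occurs only as p^2.\<close>

lemma J_fourth_phi:
  assumes q: "norm q < 1" "q \<noteq> 0"
  shows "J 1 q ^ 4 / J 2 q ^ 2 = J 4 q ^ 10 / (J 2 q ^ 4 * J 8 q ^ 4) - 4 * q * (J 8 q ^ 4 / J 4 q ^ 2)"
proof -
  define p where "p = csqrt q"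
  have p2: "p\<^sup>2 = q"
    by (simp add: p_def)
  have p: "norm p < 1" "p \<noteq> 0"
    using q p2 by (auto simp: p_def)
  have nz: "J m p \<noteq> 0" if "m > 0" for m
    using J_nonzero[OF p(1) that] .
  have "(J 1 p ^ 2 / J 2 p) * (J 2 p ^ 5 / (J 1 p ^ 2 * J 4 p ^ 2)) =
     (J 8 p ^ 5 / (J 4 p ^ 2 * J 16 p ^ 2))\<^sup>2 - (2 * p * (J 16 p ^ 2 / J 8 p))\<^sup>2"
    unfolding J_phi[OF p] by (simp add: power2_eq_square algebra_simps)
  then have "(J 2 p ^ 4 / J 4 p ^ 2) = J 8 p ^ 10 / (J 4 p ^ 4 * J 16 p ^ 4) - 4 * p\<^sup>2 * (J 16 p ^ 4 / J 8 p ^ 2)"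
    using nz by (simp add: power_numeral_reduce mult_ac)
  moreover have "J m q = J (2 * m) p" for m
    unfolding p2[symmetric] by (rule J_power)
  ultimately show ?thesis
    unfolding p2 by simp
qed

text \<open>1/J_1^4 contains phi(q)^2, which exceeds phi(-q)^2 by 8 q phi(q^4) psi(q^8) = 8 q
  psi(q^4)^2. Together with -4 q psi(q^4)^2 from \<open>J_fourth_phi\<close> this leaves the
  coefficient 4.\<close>

lemma J_fourth_dissection:
  assumes q: "norm q < 1" "q \<noteq> 0"
  shows "1 / J 1 q ^ 4 = J 4 q ^ 14 / (J 2 q ^ 14 * J 8 q ^ 4) + 4 * q * (J 4 q ^ 2 * J 8 q ^ 4 / J 2 q ^ 10)"
proof -
  have nz: "J 1 q \<noteq> 0" "J 2 q \<noteq> 0" "J 4 q \<noteq> 0" "J 8 q \<noteq> 0" "J 16 q \<noteq> 0"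
    using J_nonzero[OF q(1)] by auto
  have "(J 2 q ^ 5 / (J 1 q ^ 2 * J 4 q ^ 2))\<^sup>2 = (J 1 q ^ 2 / J 2 q)\<^sup>2
      + 8 * q * (J 8 q ^ 5 / (J 4 q ^ 2 * J 16 q ^ 2)) * (J 16 q ^ 2 / J 8 q)"
    unfolding J_phi[OF q] by (simp add: power2_eq_square algebra_simps)
  also have "(J 1 q ^ 2 / J 2 q)\<^sup>2 = J 1 q ^ 4 / J 2 q ^ 2"
    by (simp add: power_divide power_mult[symmetric])
  also have "\<dots> = J 4 q ^ 10 / (J 2 q ^ 4 * J 8 q ^ 4) - 4 * q * (J 8 q ^ 4 / J 4 q ^ 2)"
    by (rule J_fourth_phi[OF q])
  also have "8 * q * (J 8 q ^ 5 / (J 4 q ^ 2 * J 16 q ^ 2)) * (J 16 q ^ 2 / J 8 q) = 8 * q * (J 8 q ^ 4 / J 4 q ^ 2)"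
    using nz by (simp add: power_numeral_reduce)
  finally have *: "(J 2 q ^ 5 / (J 1 q ^ 2 * J 4 q ^ 2))\<^sup>2 = J 4 q ^ 10 / (J 2 q ^ 4 * J 8 q ^ 4) + 4 * q * (J 8 q ^ 4 / J 4 q ^ 2)"
    by simp
  have "1 / J 1 q ^ 4 = J 4 q ^ 4 / J 2 q ^ 10 * (J 2 q ^ 5 / (J 1 q ^ 2 * J 4 q ^ 2))\<^sup>2"
    using nz by (simp add: power_divide power_mult_distrib power_mult[symmetric])
  also have "\<dots> = J 4 q ^ 14 / (J 2 q ^ 14 * J 8 q ^ 4) + 4 * q * (J 4 q ^ 2 * J 8 q ^ 4 / J 2 q ^ 10)"
    unfolding * using nz by (simp add: distrib_left power_numeral_reduce mult_ac)
  finally show ?thesis .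
qed

text \<open>The series is evaluated at both square roots of q; half sum and half difference each
  keep one parity of the index. No coefficients of power series are compared.\<close>

lemma sums_even_odd:
  fixes a :: "nat \<Rightarrow> complex"
  assumes sums: "\<And>q. norm q < 1 \<Longrightarrow> q \<noteq> 0 \<Longrightarrow> (\<lambda>n. a n * q ^ n) sums F q"
    and split: "\<And>q. norm q < 1 \<Longrightarrow> q \<noteq> 0 \<Longrightarrow> F q = E (q\<^sup>2) + q * O' (q\<^sup>2)"
    and q: "norm q < 1" "q \<noteq> 0"
  shows "(\<lambda>n. a (2 * n) * q ^ n) sums E q" and "(\<lambda>n. a (2 * n + 1) * q ^ n) sums O' q"
proof -
  define p where "p = csqrt q"
  have p2: "p\<^sup>2 = q"
    by (simp add: p_def)
  have p: "norm p < 1" "p \<noteq> 0"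
    using q p2 by (auto simp: p_def)
  have plus: "(\<lambda>n. a n * p ^ n) sums (E q + p * O' q)"
    using sums[OF p] split[OF p] p2 by simp
  have minus: "(\<lambda>n. a n * (- p) ^ n) sums (E q - p * O' q)"
    using sums[of "- p"] split[of "- p"] p p2 by simp
  have mono: "strict_mono (\<lambda>n::nat. 2 * n)" "strict_mono (\<lambda>n::nat. 2 * n + 1)"
    by (auto simp: strict_mono_def)
  have "(\<lambda>n. (a n * p ^ n + a n * (- p) ^ n) / 2) sums ((E q + p * O' q + (E q - p * O' q)) / 2)"
    by (intro sums_divide sums_add plus minus)
  then have "(\<lambda>n. (a n * p ^ n + a n * (- p) ^ n) / 2) sums E q"
    by simp
  also have "?this \<longleftrightarrow> (\<lambda>n. (a (2 * n) * p ^ (2 * n) + a (2 * n) * (- p) ^ (2 * n)) / 2) sums E q"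
  proof (rule sums_mono_reindex[OF mono(1), symmetric])
    fix n :: nat assume "n \<notin> range (\<lambda>n. 2 * n)"
    then have "odd n" by (metis evenE rangeI)
    then show "(a n * p ^ n + a n * (- p) ^ n) / 2 = 0" by simp
  qed
  also have "(\<lambda>n. (a (2 * n) * p ^ (2 * n) + a (2 * n) * (- p) ^ (2 * n)) / 2) = (\<lambda>n. a (2 * n) * q ^ n)"
    by (rule ext) (simp add: power_mult p2)
  finally show "(\<lambda>n. a (2 * n) * q ^ n) sums E q" .
  have "(\<lambda>n. (a n * p ^ n - a n * (- p) ^ n) / (2 * p)) sums ((E q + p * O' q - (E q - p * O' q)) / (2 * p))"
    by (intro sums_divide sums_diff plus minus)
  then have "(\<lambda>n. (a n * p ^ n - a n * (- p) ^ n) / (2 * p)) sums O' q"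
    using p by (simp add: field_simps)
  also have "?this \<longleftrightarrow> (\<lambda>n. (a (2 * n + 1) * p ^ (2 * n + 1) - a (2 * n + 1) * (- p) ^ (2 * n + 1)) / (2 * p)) sums O' q"
  proof (rule sums_mono_reindex[OF mono(2), symmetric])
    fix n :: nat assume "n \<notin> range (\<lambda>n. 2 * n + 1)"
    then have "even n" by (metis oddE rangeI)
    then show "(a n * p ^ n - a n * (- p) ^ n) / (2 * p) = 0" by simp
  qed
  also have "(\<lambda>n. (a (2 * n + 1) * p ^ (2 * n + 1) - a (2 * n + 1) * (- p) ^ (2 * n + 1)) / (2 * p)) = (\<lambda>n. a (2 * n + 1) * q ^ n)"
    using p by (intro ext) (simp add: power_mult p2)
  finally show "(\<lambda>n. a (2 * n + 1) * q ^ n) sums O' q" .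
qed

text \<open>The third-order mock theta function \<open>\<omega>(q) = g(q; q\<^sup>2)\<close> equals \<open>omega_odd (q\<^sup>2) / q + omega_even (q\<^sup>2)\<close>.\<close>

definition omega_odd :: "complex \<Rightarrow> complex" where
  "omega_odd q = - 1 + g (- 1) (q ^ 4) + 1 / 2 * (J 2 q ^ 6 * J 4 q / (J 1 q ^ 4 * J 8 q ^ 2))"

definition omega_even :: "complex \<Rightarrow> complex" where
  "omega_even q = - (q * g (- (q ^ 2)) (q ^ 4)) + J 2 q ^ 8 * J 8 q ^ 2 / (J 1 q ^ 4 * J 4 q ^ 5)"

text \<open>In \<open>g_odd_dissection\<close> only 1/J_1^2 mixes parities;
  \<open>J_square_dissection\<close> distributes it over the two parts.\<close>

lemma g_odd_eq:
  assumes q: "norm q < 1" "q \<noteq> 0"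
  shows "g q (q\<^sup>2) = omega_odd (q\<^sup>2) / q + omega_even (q\<^sup>2)"
proof -
  have nz: "J 1 q \<noteq> 0" "J 2 q \<noteq> 0" "J 4 q \<noteq> 0" "J 8 q \<noteq> 0" "J 16 q \<noteq> 0"
    using J_nonzero[OF q(1)] by auto
  have pows: "(q\<^sup>2) ^ 4 = q ^ 8" "(q\<^sup>2)\<^sup>2 = q ^ 4"
    by (simp_all flip: power_mult)
  have "J 2 q * J 4 q ^ 6 / (2 * q * J 8 q ^ 4 * J 1 q ^ 2) = J 2 q * J 4 q ^ 6 / (2 * q * J 8 q ^ 4) * (1 / J 1 q ^ 2)"
    by simp
  also have "\<dots> = 1 / 2 * (J 4 q ^ 6 * J 8 q / (J 2 q ^ 4 * J 16 q ^ 2)) / q + J 4 q ^ 8 * J 16 q ^ 2 / (J 2 q ^ 4 * J 8 q ^ 5)"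
    unfolding J_square_dissection[OF q] using nz q by (simp add: distrib_left power_numeral_reduce mult_ac)
  finally show ?thesis
    unfolding g_odd_dissection[OF q] omega_odd_def omega_even_def J_power pows
    by (simp add: add_divide_distrib diff_divide_distrib)
qed

lemma g_neg_odd_eq:
  assumes q: "norm q < 1" "q \<noteq> 0"
  shows "g (- q) (q\<^sup>2) = - omega_odd (q\<^sup>2) / q + omega_even (q\<^sup>2)"
  using g_odd_eq[of "- q"] q by simp

text \<open>In the first seven equations the only factor that is not a function of q^2 is a power of
  1/J_1, namely its square, fourth or eighth power. The last two take half the sum and half the
  difference of phi(q) and phi(-q), times J_2^4/J_1^4; they merge the pairs of products that arise
  modulo 4.\<close>

lemma J_quotient_dissections:
  assumes q: "norm q < 1" "q \<noteq> 0"
  shows "J 2 q ^ 8 * J 8 q ^ 2 / (J 1 q ^ 4 * J 4 q ^ 5) =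
      J 4 q ^ 9 / (J 2 q ^ 6 * J 8 q ^ 2) + q * (4 * (J 8 q ^ 6 / (J 2 q ^ 2 * J 4 q ^ 3)))" (is ?T1)
    and "J 2 q ^ 6 * J 4 q / (J 1 q ^ 4 * J 8 q ^ 2) =
      J 4 q ^ 15 / (J 2 q ^ 8 * J 8 q ^ 6) + q * (4 * (J 4 q ^ 3 * J 8 q ^ 2 / J 2 q ^ 4))" (is ?T2)
    and "J 2 q ^ 4 * J 8 q ^ 5 / (J 1 q ^ 4 * J 4 q ^ 2 * J 16 q ^ 2) =
      J 4 q ^ 12 * J 8 q / (J 2 q ^ 10 * J 16 q ^ 2) + q * (4 * (J 8 q ^ 9 / (J 2 q ^ 6 * J 16 q ^ 2)))" (is ?T3)
    and "J 4 q ^ 6 / (J 1 q ^ 2 * J 2 q ^ 3) =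
      J 4 q ^ 6 * J 8 q ^ 5 / (J 2 q ^ 8 * J 16 q ^ 2) + q * (2 * (J 4 q ^ 8 * J 16 q ^ 2 / (J 2 q ^ 8 * J 8 q)))" (is ?T4)
    and "J 2 q ^ 15 / (J 1 q ^ 8 * J 4 q ^ 6) =
      J 4 q ^ 22 / (J 2 q ^ 13 * J 8 q ^ 8) + q\<^sup>2 * (16 * (J 8 q ^ 8 / (J 2 q ^ 5 * J 4 q ^ 2)))
        + q * (8 * (J 4 q ^ 10 / J 2 q ^ 9))" (is ?T5)
    and "J 2 q ^ 3 * J 4 q ^ 2 / J 1 q ^ 4 =
      J 4 q ^ 16 / (J 2 q ^ 11 * J 8 q ^ 4) + q * (4 * (J 4 q ^ 4 * J 8 q ^ 4 / J 2 q ^ 7))" (is ?T6)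
    and "J 2 q ^ 4 * J 16 q ^ 2 / (J 1 q ^ 4 * J 8 q) =
      J 4 q ^ 14 * J 16 q ^ 2 / (J 2 q ^ 10 * J 8 q ^ 5) + q * (4 * (J 4 q ^ 2 * J 8 q ^ 3 * J 16 q ^ 2 / J 2 q ^ 6))" (is ?T7)
    and "1 / 2 * (J 2 q ^ 9 / (J 1 q ^ 6 * J 4 q ^ 2) + J 2 q ^ 3 / J 1 q ^ 2) =
      J 2 q ^ 4 * J 8 q ^ 5 / (J 1 q ^ 4 * J 4 q ^ 2 * J 16 q ^ 2)" (is ?T8)
    and "1 / 2 * (J 2 q ^ 9 / (J 1 q ^ 6 * J 4 q ^ 2) - J 2 q ^ 3 / J 1 q ^ 2) =
      2 * q * (J 2 q ^ 4 * J 16 q ^ 2 / (J 1 q ^ 4 * J 8 q))" (is ?T9)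
proof -
  have nz: "J 1 q \<noteq> 0" "J 2 q \<noteq> 0" "J 4 q \<noteq> 0" "J 8 q \<noteq> 0" "J 16 q \<noteq> 0"
    using J_nonzero[OF q(1)] by auto
  have "J 2 q ^ 8 * J 8 q ^ 2 / (J 1 q ^ 4 * J 4 q ^ 5) = J 2 q ^ 8 * J 8 q ^ 2 / J 4 q ^ 5 * (1 / J 1 q ^ 4)"
    by (simp add: mult_ac)
  then show ?T1
    unfolding J_fourth_dissection[OF q] using nz by (simp add: distrib_left power_numeral_reduce mult_ac)
  have "J 2 q ^ 6 * J 4 q / (J 1 q ^ 4 * J 8 q ^ 2) = J 2 q ^ 6 * J 4 q / J 8 q ^ 2 * (1 / J 1 q ^ 4)"
    by (simp add: mult_ac)
  then show ?T2
    unfolding J_fourth_dissection[OF q] using nz by (simp add: distrib_left power_numeral_reduce mult_ac)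
  have "J 2 q ^ 4 * J 8 q ^ 5 / (J 1 q ^ 4 * J 4 q ^ 2 * J 16 q ^ 2) = J 2 q ^ 4 * J 8 q ^ 5 / (J 4 q ^ 2 * J 16 q ^ 2) * (1 / J 1 q ^ 4)"
    by (simp add: mult_ac)
  then show ?T3
    unfolding J_fourth_dissection[OF q] using nz by (simp add: distrib_left power_numeral_reduce mult_ac)
  have "J 2 q ^ 3 * J 4 q ^ 2 / J 1 q ^ 4 = J 2 q ^ 3 * J 4 q ^ 2 * (1 / J 1 q ^ 4)"
    by (simp add: mult_ac)
  then show ?T6
    unfolding J_fourth_dissection[OF q] using nz by (simp add: distrib_left power_numeral_reduce mult_ac)
  have "J 2 q ^ 4 * J 16 q ^ 2 / (J 1 q ^ 4 * J 8 q) = J 2 q ^ 4 * J 16 q ^ 2 / J 8 q * (1 / J 1 q ^ 4)"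
    by (simp add: mult_ac)
  then show ?T7
    unfolding J_fourth_dissection[OF q] using nz by (simp add: distrib_left power_numeral_reduce mult_ac)
  have "J 4 q ^ 6 / (J 1 q ^ 2 * J 2 q ^ 3) = J 4 q ^ 6 / J 2 q ^ 3 * (1 / J 1 q ^ 2)"
    by (simp add: mult_ac)
  then show ?T4
    unfolding J_square_dissection[OF q] using nz by (simp add: distrib_left power_numeral_reduce mult_ac)
  have "J 2 q ^ 15 / (J 1 q ^ 8 * J 4 q ^ 6) = J 2 q ^ 15 / J 4 q ^ 6 * (1 / J 1 q ^ 4)\<^sup>2"
    by (simp add: power_divide power_mult[symmetric] mult_ac)
  also have "(1 / J 1 q ^ 4)\<^sup>2 = J 4 q ^ 28 / (J 2 q ^ 28 * J 8 q ^ 8) + q\<^sup>2 * (16 * (J 4 q ^ 4 * J 8 q ^ 8 / J 2 q ^ 20))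
      + q * (8 * (J 4 q ^ 16 / J 2 q ^ 24))"
    unfolding J_fourth_dissection[OF q] power2_sum using nz
    by (simp add: power_numeral_reduce mult_ac)
  finally show ?T5
    using nz by (simp add: distrib_left power_numeral_reduce mult_ac)
  have "1 / 2 * (J 2 q ^ 9 / (J 1 q ^ 6 * J 4 q ^ 2) + J 2 q ^ 3 / J 1 q ^ 2) =
      J 2 q ^ 4 / J 1 q ^ 4 * ((J 2 q ^ 5 / (J 1 q ^ 2 * J 4 q ^ 2) + J 1 q ^ 2 / J 2 q) / 2)"
    using nz by (simp add: distrib_left power_numeral_reduce mult_ac)
  also have "J 2 q ^ 5 / (J 1 q ^ 2 * J 4 q ^ 2) + J 1 q ^ 2 / J 2 q = 2 * (J 8 q ^ 5 / (J 4 q ^ 2 * J 16 q ^ 2))"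
    unfolding J_phi[OF q] by simp
  finally show ?T8
    by (simp add: mult_ac)
  have "1 / 2 * (J 2 q ^ 9 / (J 1 q ^ 6 * J 4 q ^ 2) - J 2 q ^ 3 / J 1 q ^ 2) =
      J 2 q ^ 4 / J 1 q ^ 4 * ((J 2 q ^ 5 / (J 1 q ^ 2 * J 4 q ^ 2) - J 1 q ^ 2 / J 2 q) / 2)"
    using nz by (simp add: right_diff_distrib power_numeral_reduce mult_ac)
  also have "J 2 q ^ 5 / (J 1 q ^ 2 * J 4 q ^ 2) - J 1 q ^ 2 / J 2 q = 4 * q * (J 16 q ^ 2 / J 8 q)"
    unfolding J_phi[OF q] by simp
  finally show ?T9
    by (simp add: mult_ac)
qed

section \<open>Halving the progressions: indices modulo 2, 4 and 8\<close>

lemma J_square_arg: "J 1 (q\<^sup>2) = J 2 q" "J 2 (q\<^sup>2) = J 4 q" "J 4 (q\<^sup>2) = J 8 q" "J 8 (q\<^sup>2) = J 16 q" "J 16 (q\<^sup>2) = J 32 q"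
  unfolding J_power by simp_all

text \<open>All entries of a symbol are odd, so its rank is even exactly when n is odd. On odd n,
  \<open>omega_even\<close> contains omega(-q^2) and \<open>nu\<close> contains omega(q^2).
  Splitting omega once more, their sum keeps only \<open>omega_even (q ^ 4)\<close> and their
  difference only \<open>omega_odd (q ^ 4)\<close>, so a single value of \<open>g\<close>
  remains.\<close>

lemma N0_mod_2:
  assumes q: "norm q < 1" "q \<noteq> 0"
  shows "(\<lambda>n. of_nat (N0 0 4 (2 * n + 1)) * q ^ n) sums
      (- (q * omega_even (q ^ 4)) + 1 / 2 * (J 2 q ^ 8 * J 8 q ^ 2 / (J 1 q ^ 4 * J 4 q ^ 5) + J 4 q ^ 3 / J 2 q ^ 2))" (is ?A)
    and "(\<lambda>n. of_nat (N0 1 4 (2 * n)) * q ^ n) sums (1 / 2 * omega_odd q)" (is ?B)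
    and "(\<lambda>n. of_nat (N0 2 4 (2 * n + 1)) * q ^ n) sums
      (omega_odd (q ^ 4) / q + 1 / 2 * (J 2 q ^ 8 * J 8 q ^ 2 / (J 1 q ^ 4 * J 4 q ^ 5) - J 4 q ^ 3 / J 2 q ^ 2))" (is ?C)
proof -
  \<comment> \<open>The third-order mock theta function nu, in the form supplied by
    \<open>g_imaginary\<close>.\<close>
  define nu where "nu q = J 4 q ^ 3 / J 2 q ^ 2 - q * g (q ^ 2) (q ^ 4)" for q
  have gs: "g (1 * q) (q\<^sup>2) = omega_odd (q\<^sup>2) / q + omega_even (q\<^sup>2)"
    "g (- 1 * q) (q\<^sup>2) = - omega_odd (q\<^sup>2) / q + omega_even (q\<^sup>2)"
    "g (\<i> * q) (q\<^sup>2) = nu (q\<^sup>2)" "g (- \<i> * q) (q\<^sup>2) = nu (q\<^sup>2)"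
    if "norm q < 1" "q \<noteq> 0" for q
    using g_odd_eq[OF that] g_neg_odd_eq[OF that] g_imaginary[OF that]
    by (simp_all add: nu_def J_power power_mult[symmetric])
  have "(\<lambda>n. of_nat (N0 0 4 n) * q ^ n) sums (0 + q * ((omega_even (q\<^sup>2) + nu (q\<^sup>2)) / 2))"
    if "norm q < 1" "q \<noteq> 0" for q
    by (rule back_subst[where P = "\<lambda>s. (\<lambda>n. of_nat (N0 0 4 n) * q ^ n) sums s", OF N0_gen_funs(1)[OF that]],
        unfold gs[OF that]) (use that in \<open>simp add: field_simps\<close>)
  from sums_even_odd(2)[where E = "\<lambda>_. 0" and O' = "\<lambda>q. (omega_even q + nu q) / 2", OF this refl q]
  have 0: "(\<lambda>n. of_nat (N0 0 4 (2 * n + 1)) * q ^ n) sums ((omega_even q + nu q) / 2)" .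
  have "(\<lambda>n. of_nat (N0 2 4 n) * q ^ n) sums (0 + q * ((omega_even (q\<^sup>2) - nu (q\<^sup>2)) / 2))"
    if "norm q < 1" "q \<noteq> 0" for q
    by (rule back_subst[where P = "\<lambda>s. (\<lambda>n. of_nat (N0 2 4 n) * q ^ n) sums s", OF N0_gen_funs(2)[OF that]],
        unfold gs[OF that]) (use that in \<open>simp add: field_simps\<close>)
  from sums_even_odd(2)[where E = "\<lambda>_. 0" and O' = "\<lambda>q. (omega_even q - nu q) / 2", OF this refl q]
  have 2: "(\<lambda>n. of_nat (N0 2 4 (2 * n + 1)) * q ^ n) sums ((omega_even q - nu q) / 2)" .
  \<comment> \<open>The values of \<open>g\<close> at i q and -i q are equal and enter with opposite
    coefficients, so they cancel.\<close>
  have "(\<lambda>n. of_nat (N0 1 4 n) * q ^ n) sums (1 / 2 * omega_odd (q\<^sup>2) + q * 0)"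
    if "norm q < 1" "q \<noteq> 0" for q
    by (rule back_subst[where P = "\<lambda>s. (\<lambda>n. of_nat (N0 1 4 n) * q ^ n) sums s", OF N0_gen_funs(3)[OF that]],
        unfold gs[OF that]) (use that in \<open>simp add: field_simps\<close>)
  from sums_even_odd(1)[where E = "\<lambda>q. 1 / 2 * omega_odd q" and O' = "\<lambda>_. 0", OF this refl q]
  show ?B .
  have q2: "norm (q\<^sup>2) < 1" "q\<^sup>2 \<noteq> 0"
    using norm_power_lt_1[OF q(1)] q by auto
  have g2: "g (q\<^sup>2) (q ^ 4) = omega_odd (q ^ 4) / q\<^sup>2 + omega_even (q ^ 4)"
    "g (- (q\<^sup>2)) (q ^ 4) = - omega_odd (q ^ 4) / q\<^sup>2 + omega_even (q ^ 4)"
    using g_odd_eq[OF q2] g_neg_odd_eq[OF q2] by (simp_all add: power_mult[symmetric])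
  have g2': "q * g (q\<^sup>2) (q ^ 4) = omega_odd (q ^ 4) / q + q * omega_even (q ^ 4)"
    "q * g (- (q\<^sup>2)) (q ^ 4) = - (omega_odd (q ^ 4) / q) + q * omega_even (q ^ 4)"
    unfolding g2 using q by (simp_all add: distrib_left right_diff_distrib power2_eq_square)
  have "(omega_even q + nu q) / 2 = - (q * omega_even (q ^ 4)) +
      1 / 2 * (J 2 q ^ 8 * J 8 q ^ 2 / (J 1 q ^ 4 * J 4 q ^ 5) + J 4 q ^ 3 / J 2 q ^ 2)"
    unfolding nu_def omega_even_def[of q] g2' by (simp add: add_divide_distrib diff_divide_distrib)
  with 0 show ?A by simp
  have "(omega_even q - nu q) / 2 = omega_odd (q ^ 4) / q +
      1 / 2 * (J 2 q ^ 8 * J 8 q ^ 2 / (J 1 q ^ 4 * J 4 q ^ 5) - J 4 q ^ 3 / J 2 q ^ 2)"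
    unfolding nu_def omega_even_def[of q] g2' by (simp add: add_divide_distrib diff_divide_distrib)
  with 2 show ?C by simp
qed

text \<open>\<open>q * omega_even (q ^ 4)\<close> is odd in q, so the mock term goes entirely to 4 n
  + 3; as \<open>omega_even (q ^ 2)\<close> it then goes to 8 n + 3.\<close>

lemma N0_0_mod_4:
  assumes q: "norm q < 1" "q \<noteq> 0"
  shows "(\<lambda>n. of_nat (N0 0 4 (4 * n + 1)) * q ^ n) sums (J 2 q ^ 4 * J 8 q ^ 5 / (J 1 q ^ 4 * J 4 q ^ 2 * J 16 q ^ 2))" (is ?A)
    and "(\<lambda>n. of_nat (N0 0 4 (4 * n + 3)) * q ^ n) sums (- omega_even (q ^ 2) + 2 * (J 4 q ^ 6 / (J 1 q ^ 2 * J 2 q ^ 3)))" (is ?B)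
proof -
  have eq: "- (q * omega_even (q ^ 4)) + 1 / 2 * (J 2 q ^ 8 * J 8 q ^ 2 / (J 1 q ^ 4 * J 4 q ^ 5) + J 4 q ^ 3 / J 2 q ^ 2) =
      J 2 (q\<^sup>2) ^ 4 * J 8 (q\<^sup>2) ^ 5 / (J 1 (q\<^sup>2) ^ 4 * J 4 (q\<^sup>2) ^ 2 * J 16 (q\<^sup>2) ^ 2) + q * (- omega_even ((q\<^sup>2) ^ 2) + 2 * (J 4 (q\<^sup>2) ^ 6 / (J 1 (q\<^sup>2) ^ 2 * J 2 (q\<^sup>2) ^ 3)))"
    if "norm q < 1" "q \<noteq> 0" for q
  proof -
    have q2: "norm (q\<^sup>2) < 1" "q\<^sup>2 \<noteq> 0"
      using norm_power_lt_1[OF that(1)] that by auto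
    \<comment> \<open>The even part of the first product and the even term J_4^3/J_2^2 merge into a
      single quotient.\<close>
    note half = J_quotient_dissections(8)[OF q2, unfolded J_square_arg]
    show ?thesis
      unfolding J_quotient_dissections(1)[OF that] J_square_arg half[symmetric] using that
      by (simp add: power_mult[symmetric] add_divide_distrib diff_divide_distrib algebra_simps)
  qed
  note sums = sums_even_odd[where E = "\<lambda>q. J 2 q ^ 4 * J 8 q ^ 5 / (J 1 q ^ 4 * J 4 q ^ 2 * J 16 q ^ 2)"
      and O' = "\<lambda>q. - omega_even (q ^ 2) + 2 * (J 4 q ^ 6 / (J 1 q ^ 2 * J 2 q ^ 3))", OF N0_mod_2(1) eq q]
  have args: "2 * (2 * n) + 1 = 4 * n + 1" "2 * (2 * n + 1) + 1 = 4 * n + 3" for n :: nat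
    by simp_all
  show ?A
    by (rule sums(1)[unfolded args])
  show ?B
    by (rule sums(2)[unfolded args])
qed

lemma N0_0_mod_8_1:
  assumes q: "norm q < 1" "q \<noteq> 0"
  shows "(\<lambda>n. of_nat (N0 0 4 (8 * n + 1)) * q ^ n) sums (J 2 q ^ 12 * J 4 q / (J 1 q ^ 10 * J 8 q ^ 2))" (is ?A)
    and "(\<lambda>n. of_nat (N0 0 4 (8 * n + 5)) * q ^ n) sums (4 * (J 4 q ^ 9 / (J 1 q ^ 6 * J 8 q ^ 2)))" (is ?B)
proof -
  have eq: "J 2 q ^ 4 * J 8 q ^ 5 / (J 1 q ^ 4 * J 4 q ^ 2 * J 16 q ^ 2) =
      J 2 (q\<^sup>2) ^ 12 * J 4 (q\<^sup>2) / (J 1 (q\<^sup>2) ^ 10 * J 8 (q\<^sup>2) ^ 2) + q * (4 * (J 4 (q\<^sup>2) ^ 9 / (J 1 (q\<^sup>2) ^ 6 * J 8 (q\<^sup>2) ^ 2)))"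
    if "norm q < 1" "q \<noteq> 0" for q
    unfolding J_quotient_dissections(3)[OF that] J_square_arg using that
    by (simp add: power_mult[symmetric] algebra_simps)
  note sums = sums_even_odd[where E = "\<lambda>q. J 2 q ^ 12 * J 4 q / (J 1 q ^ 10 * J 8 q ^ 2)"
      and O' = "\<lambda>q. 4 * (J 4 q ^ 9 / (J 1 q ^ 6 * J 8 q ^ 2))", OF N0_0_mod_4(1) eq q]
  have args: "4 * (2 * n) + 1 = 8 * n + 1" "4 * (2 * n + 1) + 1 = 8 * n + 5" for n :: nat
    by simp_all
  show ?A
    by (rule sums(1)[unfolded args])
  show ?B
    by (rule sums(2)[unfolded args])
qed

lemma N0_0_mod_8_3:
  assumes q: "norm q < 1" "q \<noteq> 0"
  shows "(\<lambda>n. of_nat (N0 0 4 (8 * n + 3)) * q ^ n) sums (- omega_even q + 2 * (J 2 q ^ 6 * J 4 q ^ 5 / (J 1 q ^ 8 * J 8 q ^ 2)))" (is ?A)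
    and "(\<lambda>n. of_nat (N0 0 4 (8 * n + 7)) * q ^ n) sums (4 * (J 2 q ^ 8 * J 8 q ^ 2 / (J 1 q ^ 8 * J 4 q)))" (is ?B)
proof -
  have eq: "- omega_even (q ^ 2) + 2 * (J 4 q ^ 6 / (J 1 q ^ 2 * J 2 q ^ 3)) =
      - omega_even (q\<^sup>2) + 2 * (J 2 (q\<^sup>2) ^ 6 * J 4 (q\<^sup>2) ^ 5 / (J 1 (q\<^sup>2) ^ 8 * J 8 (q\<^sup>2) ^ 2)) + q * (4 * (J 2 (q\<^sup>2) ^ 8 * J 8 (q\<^sup>2) ^ 2 / (J 1 (q\<^sup>2) ^ 8 * J 4 (q\<^sup>2))))"
    if "norm q < 1" "q \<noteq> 0" for q
    unfolding J_quotient_dissections(4)[OF that] J_square_arg using that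
    by (simp add: power_mult[symmetric] algebra_simps)
  note sums = sums_even_odd[where E = "\<lambda>q. - omega_even q + 2 * (J 2 q ^ 6 * J 4 q ^ 5 / (J 1 q ^ 8 * J 8 q ^ 2))"
      and O' = "\<lambda>q. 4 * (J 2 q ^ 8 * J 8 q ^ 2 / (J 1 q ^ 8 * J 4 q))", OF N0_0_mod_4(2) eq q]
  have args: "4 * (2 * n) + 3 = 8 * n + 3" "4 * (2 * n + 1) + 3 = 8 * n + 7" for n :: nat
    by simp_all
  show ?A
    by (rule sums(1)[unfolded args])
  show ?B
    by (rule sums(2)[unfolded args])
qed

text \<open>The \<open>g\<close> inside \<open>omega_odd q\<close> depends on q^4 only, so it stays
  with the multiples of 4 here and with the multiples of 8 at the next halving.\<close>

lemma N0_1_mod_4: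
  assumes q: "norm q < 1" "q \<noteq> 0"
  shows "(\<lambda>n. of_nat (N0 1 4 (4 * n)) * q ^ n) sums (- (1 / 2) + 1 / 2 * g (- 1) (q ^ 2) + 1 / 4 * (J 2 q ^ 15 / (J 1 q ^ 8 * J 4 q ^ 6)))" (is ?A)
    and "(\<lambda>n. of_nat (N0 1 4 (4 * n + 2)) * q ^ n) sums (J 2 q ^ 3 * J 4 q ^ 2 / J 1 q ^ 4)" (is ?B)
proof -
  have eq: "1 / 2 * omega_odd q =
      - (1 / 2) + 1 / 2 * g (- 1) ((q\<^sup>2) ^ 2) + 1 / 4 * (J 2 (q\<^sup>2) ^ 15 / (J 1 (q\<^sup>2) ^ 8 * J 4 (q\<^sup>2) ^ 6)) + q * (J 2 (q\<^sup>2) ^ 3 * J 4 (q\<^sup>2) ^ 2 / J 1 (q\<^sup>2) ^ 4)"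
    if "norm q < 1" "q \<noteq> 0" for q
    unfolding omega_odd_def J_quotient_dissections(2)[OF that] J_square_arg using that
    by (simp add: power_mult[symmetric] algebra_simps)
  note sums = sums_even_odd[where E = "\<lambda>q. - (1 / 2) + 1 / 2 * g (- 1) (q ^ 2) + 1 / 4 * (J 2 q ^ 15 / (J 1 q ^ 8 * J 4 q ^ 6))"
      and O' = "\<lambda>q. J 2 q ^ 3 * J 4 q ^ 2 / J 1 q ^ 4", OF N0_mod_2(2) eq q]
  have args: "2 * (2 * n) = 4 * n" "2 * (2 * n + 1) = 4 * n + 2" for n :: nat
    by simp_all
  show ?A
    by (rule sums(1)[unfolded args])
  show ?B
    by (rule sums(2)[unfolded args])
qed

lemma N0_1_mod_8_0:
  assumes q: "norm q < 1" "q \<noteq> 0"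
  shows "(\<lambda>n. of_nat (N0 1 4 (8 * n)) * q ^ n) sums (- (1 / 2) + 1 / 2 * g (- 1) q + 1 / 4 * (J 2 q ^ 22 / (J 1 q ^ 13 * J 4 q ^ 8)) + 4 * q * (J 4 q ^ 8 / (J 1 q ^ 5 * J 2 q ^ 2)))" (is ?A)
    and "(\<lambda>n. of_nat (N0 1 4 (8 * n + 4)) * q ^ n) sums (2 * (J 2 q ^ 10 / J 1 q ^ 9))" (is ?B)
proof -
  \<comment> \<open>The term with 4 q^2 is the square of the odd part of 1/J_1^4; being even, it
    adds a second product to the class 8 n.\<close>
  have eq: "- (1 / 2) + 1 / 2 * g (- 1) (q ^ 2) + 1 / 4 * (J 2 q ^ 15 / (J 1 q ^ 8 * J 4 q ^ 6)) =
      - (1 / 2) + 1 / 2 * g (- 1) (q\<^sup>2) + 1 / 4 * (J 2 (q\<^sup>2) ^ 22 / (J 1 (q\<^sup>2) ^ 13 * J 4 (q\<^sup>2) ^ 8)) + 4 * (q\<^sup>2) * (J 4 (q\<^sup>2) ^ 8 / (J 1 (q\<^sup>2) ^ 5 * J 2 (q\<^sup>2) ^ 2)) + q * (2 * (J 2 (q\<^sup>2) ^ 10 / J 1 (q\<^sup>2) ^ 9))"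
    if "norm q < 1" "q \<noteq> 0" for q
    unfolding J_quotient_dissections(5)[OF that] J_square_arg using that
    by (simp add: power_mult[symmetric] algebra_simps)
  note sums = sums_even_odd[where E = "\<lambda>q. - (1 / 2) + 1 / 2 * g (- 1) q + 1 / 4 * (J 2 q ^ 22 / (J 1 q ^ 13 * J 4 q ^ 8)) + 4 * q * (J 4 q ^ 8 / (J 1 q ^ 5 * J 2 q ^ 2))"
      and O' = "\<lambda>q. 2 * (J 2 q ^ 10 / J 1 q ^ 9)", OF N0_1_mod_4(1) eq q]
  have args: "4 * (2 * n) = 8 * n" "4 * (2 * n + 1) = 8 * n + 4" for n :: nat
    by simp_all
  show ?A
    by (rule sums(1)[unfolded args])
  show ?B
    by (rule sums(2)[unfolded args])
qed

lemma N0_1_mod_8_2: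
  assumes q: "norm q < 1" "q \<noteq> 0"
  shows "(\<lambda>n. of_nat (N0 1 4 (8 * n + 2)) * q ^ n) sums (J 2 q ^ 16 / (J 1 q ^ 11 * J 4 q ^ 4))" (is ?A)
    and "(\<lambda>n. of_nat (N0 1 4 (8 * n + 6)) * q ^ n) sums (4 * (J 2 q ^ 4 * J 4 q ^ 4 / J 1 q ^ 7))" (is ?B)
proof -
  have eq: "J 2 q ^ 3 * J 4 q ^ 2 / J 1 q ^ 4 =
      J 2 (q\<^sup>2) ^ 16 / (J 1 (q\<^sup>2) ^ 11 * J 4 (q\<^sup>2) ^ 4) + q * (4 * (J 2 (q\<^sup>2) ^ 4 * J 4 (q\<^sup>2) ^ 4 / J 1 (q\<^sup>2) ^ 7))"
    if "norm q < 1" "q \<noteq> 0" for q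
    unfolding J_quotient_dissections(6)[OF that] J_square_arg using that
    by (simp add: power_mult[symmetric] algebra_simps)
  note sums = sums_even_odd[where E = "\<lambda>q. J 2 q ^ 16 / (J 1 q ^ 11 * J 4 q ^ 4)"
      and O' = "\<lambda>q. 4 * (J 2 q ^ 4 * J 4 q ^ 4 / J 1 q ^ 7)", OF N0_1_mod_4(2) eq q]
  have args: "4 * (2 * n) + 2 = 8 * n + 2" "4 * (2 * n + 1) + 2 = 8 * n + 6" for n :: nat
    by simp_all
  show ?A
    by (rule sums(1)[unfolded args])
  show ?B
    by (rule sums(2)[unfolded args])
qed

lemma N0_2_mod_4:
  assumes q: "norm q < 1" "q \<noteq> 0"
  shows "(\<lambda>n. of_nat (N0 2 4 (4 * n + 1)) * q ^ n) sums (2 * q * (J 2 q ^ 4 * J 16 q ^ 2 / (J 1 q ^ 4 * J 8 q)))" (is ?A)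
    and "(\<lambda>n. of_nat (N0 2 4 (4 * n + 3)) * q ^ n) sums (omega_odd (q ^ 2) / q + 2 * (J 4 q ^ 6 / (J 1 q ^ 2 * J 2 q ^ 3)))" (is ?B)
proof -
  have eq: "omega_odd (q ^ 4) / q + 1 / 2 * (J 2 q ^ 8 * J 8 q ^ 2 / (J 1 q ^ 4 * J 4 q ^ 5) - J 4 q ^ 3 / J 2 q ^ 2) =
      2 * (q\<^sup>2) * (J 2 (q\<^sup>2) ^ 4 * J 16 (q\<^sup>2) ^ 2 / (J 1 (q\<^sup>2) ^ 4 * J 8 (q\<^sup>2))) + q * (omega_odd ((q\<^sup>2) ^ 2) / (q\<^sup>2) + 2 * (J 4 (q\<^sup>2) ^ 6 / (J 1 (q\<^sup>2) ^ 2 * J 2 (q\<^sup>2) ^ 3)))"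
    if "norm q < 1" "q \<noteq> 0" for q
  proof -
    have q2: "norm (q\<^sup>2) < 1" "q\<^sup>2 \<noteq> 0"
      using norm_power_lt_1[OF that(1)] that by auto
    \<comment> \<open>Writes 1/q as q times 1/q^2, which exhibits the mock term as an odd
      one.\<close>
    have cancel: "q * (c / q\<^sup>2) = c / q" for c
      using that by (simp add: power2_eq_square)
    note half = J_quotient_dissections(9)[OF q2, unfolded J_square_arg]
    show ?thesis
      unfolding J_quotient_dissections(1)[OF that] J_square_arg half[symmetric] distrib_left[of q "_ / _"] cancel
      by (simp add: power_mult[symmetric] add_divide_distrib diff_divide_distrib algebra_simps)
  qed
  note sums = sums_even_odd[where E = "\<lambda>q. 2 * q * (J 2 q ^ 4 * J 16 q ^ 2 / (J 1 q ^ 4 * J 8 q))"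
      and O' = "\<lambda>q. omega_odd (q ^ 2) / q + 2 * (J 4 q ^ 6 / (J 1 q ^ 2 * J 2 q ^ 3))", OF N0_mod_2(3) eq q]
  have args: "2 * (2 * n) + 1 = 4 * n + 1" "2 * (2 * n + 1) + 1 = 4 * n + 3" for n :: nat
    by simp_all
  show ?A
    by (rule sums(1)[unfolded args])
  show ?B
    by (rule sums(2)[unfolded args])
qed

lemma N0_2_mod_8_1:
  assumes q: "norm q < 1" "q \<noteq> 0"
  shows "(\<lambda>n. of_nat (N0 2 4 (8 * n + 1)) * q ^ n) sums (8 * q * (J 2 q ^ 2 * J 4 q ^ 3 * J 8 q ^ 2 / J 1 q ^ 6))" (is ?A)
    and "(\<lambda>n. of_nat (N0 2 4 (8 * n + 5)) * q ^ n) sums (2 * (J 2 q ^ 14 * J 8 q ^ 2 / (J 1 q ^ 10 * J 4 q ^ 5)))" (is ?B)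
proof -
  \<comment> \<open>The prefactor q exchanges parities: the odd part of the product goes to 8 n + 1,
    the even part to 8 n + 5.\<close>
  have eq: "2 * q * (J 2 q ^ 4 * J 16 q ^ 2 / (J 1 q ^ 4 * J 8 q)) =
      8 * (q\<^sup>2) * (J 2 (q\<^sup>2) ^ 2 * J 4 (q\<^sup>2) ^ 3 * J 8 (q\<^sup>2) ^ 2 / J 1 (q\<^sup>2) ^ 6) + q * (2 * (J 2 (q\<^sup>2) ^ 14 * J 8 (q\<^sup>2) ^ 2 / (J 1 (q\<^sup>2) ^ 10 * J 4 (q\<^sup>2) ^ 5)))"
    if "norm q < 1" "q \<noteq> 0" for q
    unfolding J_quotient_dissections(7)[OF that] J_square_arg using that
    by (simp add: power_mult[symmetric] algebra_simps power2_eq_square[of q])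
  note sums = sums_even_odd[where E = "\<lambda>q. 8 * q * (J 2 q ^ 2 * J 4 q ^ 3 * J 8 q ^ 2 / J 1 q ^ 6)"
      and O' = "\<lambda>q. 2 * (J 2 q ^ 14 * J 8 q ^ 2 / (J 1 q ^ 10 * J 4 q ^ 5))", OF N0_2_mod_4(1) eq q]
  have args: "4 * (2 * n) + 1 = 8 * n + 1" "4 * (2 * n + 1) + 1 = 8 * n + 5" for n :: nat
    by simp_all
  show ?A
    by (rule sums(1)[unfolded args])
  show ?B
    by (rule sums(2)[unfolded args])
qed

lemma N0_2_mod_8_3:
  assumes q: "norm q < 1" "q \<noteq> 0"
  shows "(\<lambda>n. of_nat (N0 2 4 (8 * n + 3)) * q ^ n) sums (2 * (J 2 q ^ 6 * J 4 q ^ 5 / (J 1 q ^ 8 * J 8 q ^ 2)))" (is ?A)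
    and "(\<lambda>n. of_nat (N0 2 4 (8 * n + 7)) * q ^ n) sums (omega_odd q / q + 4 * (J 2 q ^ 8 * J 8 q ^ 2 / (J 1 q ^ 8 * J 4 q)))" (is ?B)
proof -
  have eq: "omega_odd (q ^ 2) / q + 2 * (J 4 q ^ 6 / (J 1 q ^ 2 * J 2 q ^ 3)) =
      2 * (J 2 (q\<^sup>2) ^ 6 * J 4 (q\<^sup>2) ^ 5 / (J 1 (q\<^sup>2) ^ 8 * J 8 (q\<^sup>2) ^ 2)) + q * (omega_odd (q\<^sup>2) / (q\<^sup>2) + 4 * (J 2 (q\<^sup>2) ^ 8 * J 8 (q\<^sup>2) ^ 2 / (J 1 (q\<^sup>2) ^ 8 * J 4 (q\<^sup>2))))"
    if "norm q < 1" "q \<noteq> 0" for q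
  proof -
    have cancel: "q * (c / q\<^sup>2) = c / q" for c
      using that by (simp add: power2_eq_square)
    show ?thesis
      unfolding J_quotient_dissections(4)[OF that] J_square_arg distrib_left[of q "_ / _"] cancel
      by (simp add: algebra_simps)
  qed
  note sums = sums_even_odd[where E = "\<lambda>q. 2 * (J 2 q ^ 6 * J 4 q ^ 5 / (J 1 q ^ 8 * J 8 q ^ 2))"
      and O' = "\<lambda>q. omega_odd q / q + 4 * (J 2 q ^ 8 * J 8 q ^ 2 / (J 1 q ^ 8 * J 4 q))", OF N0_2_mod_4(2) eq q]
  have args: "4 * (2 * n) + 3 = 8 * n + 3" "4 * (2 * n + 1) + 3 = 8 * n + 7" for n :: nat
    by simp_all
  show ?A
    by (rule sums(1)[unfolded args])
  show ?B
    by (rule sums(2)[unfolded args])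
qed

theorem theorem3p2:
  fixes q :: complex
  assumes "q \<noteq> 0" and "norm q < 1"
  shows
    "((\<lambda>n. of_nat (N0 0 4 (2 * n + 1)) * q ^ n) sums
        (q ^ 5 * g (- (q ^ 8)) (q ^ 16) - q * (J 8 q ^ 8 * J 32 q ^ 2 / (J 4 q ^ 4 * J 16 q ^ 5)) + 1 / 2 * ((J 2 q ^ 8 * J 8 q ^ 2 / (J 1 q ^ 4 * J 4 q ^ 5)) + (J 4 q ^ 3 / J 2 q ^ 2))) \<and>
      (\<lambda>n. of_nat (N0 0 4 (4 * n + 1)) * q ^ n) sums
        ((J 2 q ^ 4 * J 8 q ^ 5 / (J 1 q ^ 4 * J 4 q ^ 2 * J 16 q ^ 2))) \<and>
      (\<lambda>n. of_nat (N0 0 4 (4 * n + 3)) * q ^ n) sums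
        (q ^ 2 * g (- (q ^ 4)) (q ^ 8) - (J 4 q ^ 8 * J 16 q ^ 2 / (J 2 q ^ 4 * J 8 q ^ 5)) + 2 * (J 4 q ^ 6 / (J 1 q ^ 2 * J 2 q ^ 3))) \<and>
      (\<lambda>n. of_nat (N0 0 4 (8 * n + 1)) * q ^ n) sums
        ((J 2 q ^ 12 * J 4 q / (J 1 q ^ 10 * J 8 q ^ 2))) \<and>
      (\<lambda>n. of_nat (N0 0 4 (8 * n + 3)) * q ^ n) sums
        (q * g (- (q ^ 2)) (q ^ 4) + 2 * (J 2 q ^ 6 * J 4 q ^ 5 / (J 1 q ^ 8 * J 8 q ^ 2)) - (J 2 q ^ 8 * J 8 q ^ 2 / (J 1 q ^ 4 * J 4 q ^ 5))) \<and>
      (\<lambda>n. of_nat (N0 0 4 (8 * n + 5)) * q ^ n) sums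
        (4 * (J 4 q ^ 9 / (J 1 q ^ 6 * J 8 q ^ 2))) \<and>
      (\<lambda>n. of_nat (N0 0 4 (8 * n + 7)) * q ^ n) sums
        (4 * (J 2 q ^ 8 * J 8 q ^ 2 / (J 1 q ^ 8 * J 4 q)))) \<and>
     ((\<lambda>n. of_nat (N0 1 4 (2 * n)) * q ^ n) sums
        (- (1 / 2) + 1 / 2 * g (- 1) (q ^ 4) + 1 / 4 * (J 2 q ^ 6 * J 4 q / (J 1 q ^ 4 * J 8 q ^ 2))) \<and>
      (\<lambda>n. of_nat (N0 1 4 (4 * n)) * q ^ n) sums
        (- (1 / 2) + 1 / 2 * g (- 1) (q ^ 2) + 1 / 4 * (J 2 q ^ 15 / (J 1 q ^ 8 * J 4 q ^ 6))) \<and>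
      (\<lambda>n. of_nat (N0 1 4 (4 * n + 2)) * q ^ n) sums
        ((J 2 q ^ 3 * J 4 q ^ 2 / J 1 q ^ 4)) \<and>
      (\<lambda>n. of_nat (N0 1 4 (8 * n)) * q ^ n) sums
        (- (1 / 2) + 1 / 2 * g (- 1) q + 1 / 4 * (J 2 q ^ 22 / (J 1 q ^ 13 * J 4 q ^ 8)) + 4 * q * (J 4 q ^ 8 / (J 1 q ^ 5 * J 2 q ^ 2))) \<and>
      (\<lambda>n. of_nat (N0 1 4 (8 * n + 2)) * q ^ n) sums
        ((J 2 q ^ 16 / (J 1 q ^ 11 * J 4 q ^ 4))) \<and>
      (\<lambda>n. of_nat (N0 1 4 (8 * n + 4)) * q ^ n) sums
        (2 * (J 2 q ^ 10 / J 1 q ^ 9)) \<and>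
      (\<lambda>n. of_nat (N0 1 4 (8 * n + 6)) * q ^ n) sums
        (4 * (J 2 q ^ 4 * J 4 q ^ 4 / J 1 q ^ 7))) \<and>
     ((\<lambda>n. of_nat (N0 2 4 (2 * n + 1)) * q ^ n) sums
        (- inverse q + inverse q * g (- 1) (q ^ 16) + 1 / 2 * inverse q * (J 8 q ^ 6 * J 16 q / (J 4 q ^ 4 * J 32 q ^ 2)) - 1 / 2 * (J 4 q ^ 3 / J 2 q ^ 2) + 1 / 2 * (J 2 q ^ 8 * J 8 q ^ 2 / (J 1 q ^ 4 * J 4 q ^ 5))) \<and>
      (\<lambda>n. of_nat (N0 2 4 (4 * n + 1)) * q ^ n) sums
        (2 * q * (J 2 q ^ 4 * J 16 q ^ 2 / (J 1 q ^ 4 * J 8 q))) \<and>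
      (\<lambda>n. of_nat (N0 2 4 (4 * n + 3)) * q ^ n) sums
        (- inverse q + inverse q * g (- 1) (q ^ 8) + 1 / 2 * inverse q * (J 4 q ^ 6 * J 8 q / (J 2 q ^ 4 * J 16 q ^ 2)) + 2 * (J 4 q ^ 6 / (J 1 q ^ 2 * J 2 q ^ 3))) \<and>
      (\<lambda>n. of_nat (N0 2 4 (8 * n + 1)) * q ^ n) sums
        (8 * q * (J 2 q ^ 2 * J 4 q ^ 3 * J 8 q ^ 2 / J 1 q ^ 6)) \<and>
      (\<lambda>n. of_nat (N0 2 4 (8 * n + 3)) * q ^ n) sums
        (2 * (J 2 q ^ 6 * J 4 q ^ 5 / (J 1 q ^ 8 * J 8 q ^ 2))) \<and>
      (\<lambda>n. of_nat (N0 2 4 (8 * n + 5)) * q ^ n) sums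
        (2 * (J 2 q ^ 14 * J 8 q ^ 2 / (J 1 q ^ 10 * J 4 q ^ 5))) \<and>
      (\<lambda>n. of_nat (N0 2 4 (8 * n + 7)) * q ^ n) sums
        (- inverse q + inverse q * g (- 1) (q ^ 4) + 1 / 2 * inverse q * (J 2 q ^ 6 * J 4 q / (J 1 q ^ 4 * J 8 q ^ 2)) + 4 * (J 2 q ^ 8 * J 8 q ^ 2 / (J 1 q ^ 8 * J 4 q))))"
  proof -
  have q: "norm q < 1" "q \<noteq> 0"
    using assms by auto
  have even: "omega_even (q ^ 4) = - (q ^ 4 * g (- (q ^ 8)) (q ^ 16)) + J 8 q ^ 8 * J 32 q ^ 2 / (J 4 q ^ 4 * J 16 q ^ 5)"
    "omega_even (q ^ 2) = - (q ^ 2 * g (- (q ^ 4)) (q ^ 8)) + J 4 q ^ 8 * J 16 q ^ 2 / (J 2 q ^ 4 * J 8 q ^ 5)"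
    unfolding omega_even_def J_square_arg by (simp_all add: J_power power_mult[symmetric])
  have odd: "omega_odd (q ^ 4) = - 1 + g (- 1) (q ^ 16) + 1 / 2 * (J 8 q ^ 6 * J 16 q / (J 4 q ^ 4 * J 32 q ^ 2))"
    "omega_odd (q ^ 2) = - 1 + g (- 1) (q ^ 8) + 1 / 2 * (J 4 q ^ 6 * J 8 q / (J 2 q ^ 4 * J 16 q ^ 2))"
    unfolding omega_odd_def J_square_arg by (simp_all add: J_power power_mult[symmetric])
  have pow: "q * (q ^ 4 * x) = q ^ 5 * x" for x
    by (simp add: power_numeral_reduce)
  have quot: "(- 1 + a + 1 / 2 * b) / q = - inverse q + inverse q * a + 1 / 2 * inverse q * b" for a b
    using q by (simp add: field_simps)
  show ?thesis
  \<comment> \<open>The goals treated one by one are those proved in terms of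
    \<open>omega_even\<close> or \<open>omega_odd\<close>; the others agree verbatim with the lemmas
    above.\<close>
  proof (intro conjI, goal_cases)
    case 1
    show ?case
      by (rule back_subst[of "(sums) _", OF N0_mod_2(1)[OF q]])
        (unfold even, simp add: distrib_left right_diff_distrib pow)
  next
    case 3
    show ?case
      by (rule back_subst[of "(sums) _", OF N0_0_mod_4(2)[OF q]]) (unfold even, simp)
  next
    case 5
    show ?case
      by (rule back_subst[of "(sums) _", OF N0_0_mod_8_3(1)[OF q]]) (unfold omega_even_def, simp)
  next
    case 8
    show ?case
      by (rule back_subst[of "(sums) _", OF N0_mod_2(2)[OF q]]) (unfold omega_odd_def, simp add: distrib_left)
  next
    case 15
    show ?case
      by (rule back_subst[of "(sums) _", OF N0_mod_2(3)[OF q]]) (unfold odd quot, simp add: right_diff_distrib)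
  next
    case 17
    show ?case
      by (rule back_subst[of "(sums) _", OF N0_2_mod_4(2)[OF q]]) (unfold odd quot, rule refl)
  next
    case 21
    show ?case
      by (rule back_subst[of "(sums) _", OF N0_2_mod_8_3(2)[OF q]]) (unfold omega_odd_def quot, rule refl)
  qed (rule N0_0_mod_4[OF q] N0_0_mod_8_1[OF q] N0_0_mod_8_3[OF q] N0_1_mod_4[OF q] N0_1_mod_8_0[OF q]
      N0_1_mod_8_2[OF q] N0_2_mod_4[OF q] N0_2_mod_8_1[OF q] N0_2_mod_8_3[OF q])+
qed

end
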